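(* There are absolute constants $\varepsilon_0>0$ and $C>0$ such that, if $0<\varepsilon\le\varepsilon_0$ and $f:\mathbb{H}\to\mathbb{H}$ is a $(1+\varepsilon)$-biLipschitz map with $f(0)=0$, then for any $R>0$ there is $A\in O(2)$ such that $$d\big(f(z;0),(Az;0)\big)\le C\varepsilon^{1/16}R\qquad\text{for all } z\in\mathbb{R}^2 \text{ with } |z|\le R.$$
   Context: The Heisenberg group $\mathbb{H}$ is $\mathbb{R}^3$, with points written $(x,y,t)=(z;t)$, $z=x+iy\in\mathbb{C}\simeq\mathbb{R}^2$, and product $(x,y,t)\cdot(x',y',t')=(x+x',y+y',t+t'+2(x'y-xy'))$. Left-invariant horizontal fields: $X=\partial_x+2y\,\partial_t$, $Y=\partial_y-2x\,\partial_t$. A horizontal curve is an absolutely continuous $\gamma:[\alpha,\beta]\to\mathbb{H}$ with $\dot\gamma=aX_\gamma+bY_\gamma$ a.e. for some measurable $a,b$; its length is $\int_\alpha^\beta\sqrt{a^2+b^2}$. The control distance $d(P,Q)$ is the infimum of lengths of horizontal curves joining $P$ and $Q$. A map $f:\mathbb{H}\to\mathbb{H}$ is $(1+\varepsilon)$-biLipschitz if $(1+\varepsilon)^{-1}d(P,Q)\le d(f(P),f(Q))\le(1+\varepsilon)d(P,Q)$ for all $P,Q\in\mathbb{H}$. *)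

theory Defs
  imports "HOL-Analysis.Analysis"
begin

text \<open>A point \<open>(z, t)\<close> has \<open>z = (x, y) \<in> \<real>\<^sup>2\<close>. As a normed space the type below is
  Euclidean 3-space, so derivatives of curves are the usual ones; the control distance is
  unrelated to the type's own \<open>dist\<close>.\<close>

type_synonym heis = "(real ^ 2) \<times> real"

definition heis_mult :: "heis \<Rightarrow> heis \<Rightarrow> heis" where
  "heis_mult P Q =
    (fst P + fst Q, snd P + snd Q + 2 * (fst Q $ 1 * fst P $ 2 - fst P $ 1 * fst Q $ 2))"

definition heis_X :: "heis \<Rightarrow> heis" where
  "heis_X P = (vector [1, 0], 2 * fst P $ 2)"

definition heis_Y :: "heis \<Rightarrow> heis" where
  "heis_Y P = (vector [0, 1], - 2 * fst P $ 1)"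

text \<open>The two fields are left-invariant: they arise by differentiating right multiplication by
  the coordinate one-parameter subgroups.\<close>

lemma heis_X_left_invariant:
  "((\<lambda>s. heis_mult P (s *\<^sub>R (vector [1, 0], 0))) has_vector_derivative heis_X P) (at 0)"
proof -
  have "heis_mult P (s *\<^sub>R (vector [1, 0], 0)) = P + s *\<^sub>R heis_X P" for s
    by (cases P) (simp add: heis_mult_def heis_X_def vector_2)
  then show ?thesis
    by (auto intro!: derivative_eq_intros)
qed

lemma heis_Y_left_invariant:
  "((\<lambda>s. heis_mult P (s *\<^sub>R (vector [0, 1], 0))) has_vector_derivative heis_Y P) (at 0)"
proof -
  have "heis_mult P (s *\<^sub>R (vector [0, 1], 0)) = P + s *\<^sub>R heis_Y P" for s
    by (cases P) (simp add: heis_mult_def heis_Y_def vector_2)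
  then show ?thesis
    by (auto intro!: derivative_eq_intros)
qed

text \<open>Absolute continuity of functions on an interval; the library's \<open>absolutely_continuous\<close>
  is the relation between measures. A finite family of non-overlapping subintervals
  \<open>[u, v]\<close> is encoded as the set of its endpoint pairs \<open>(u, v)\<close>.\<close>

definition abs_continuous_on_interval ::
    "real \<Rightarrow> real \<Rightarrow> (real \<Rightarrow> 'a :: metric_space) \<Rightarrow> bool" where
  "abs_continuous_on_interval \<alpha> \<beta> g \<longleftrightarrow>
    (\<forall>e>0. \<exists>\<delta>>0. \<forall>D :: (real \<times> real) set.
      finite D \<and>
      (\<forall>(u, v)\<in>D. \<alpha> \<le> u \<and> u \<le> v \<and> v \<le> \<beta>) \<and>
      pairwise (\<lambda>(u, v) (u', v'). {u<..<v} \<inter> {u'<..<v'} = {}) D \<and>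
      (\<Sum>(u, v)\<in>D. v - u) < \<delta>
      \<longrightarrow> (\<Sum>(u, v)\<in>D. dist (g u) (g v)) < e)"

definition horizontal_curve ::
    "real \<Rightarrow> real \<Rightarrow> (real \<Rightarrow> heis) \<Rightarrow> (real \<Rightarrow> real) \<Rightarrow> (real \<Rightarrow> real) \<Rightarrow> bool" where
  "horizontal_curve \<alpha> \<beta> \<gamma> a b \<longleftrightarrow>
    \<alpha> < \<beta> \<and>
    abs_continuous_on_interval \<alpha> \<beta> \<gamma> \<and>
    a \<in> borel_measurable (lebesgue_on {\<alpha>..\<beta>}) \<and>
    b \<in> borel_measurable (lebesgue_on {\<alpha>..\<beta>}) \<and>
    (AE s in lebesgue_on {\<alpha>..\<beta>}.
      (\<gamma> has_vector_derivative a s *\<^sub>R heis_X (\<gamma> s) + b s *\<^sub>R heis_Y (\<gamma> s))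
        (at s within {\<alpha>..\<beta>}))"

text \<open>The controls \<open>a\<close>, \<open>b\<close> of a horizontal curve agree almost everywhere with the
  derivatives of its first two coordinates. They are therefore integrable and determined by the
  curve up to null sets, and the integral below is its length.\<close>

definition horizontal_length ::
    "real \<Rightarrow> real \<Rightarrow> (real \<Rightarrow> real) \<Rightarrow> (real \<Rightarrow> real) \<Rightarrow> real" where
  "horizontal_length \<alpha> \<beta> a b = (LINT s | lebesgue_on {\<alpha>..\<beta>}. sqrt ((a s)\<^sup>2 + (b s)\<^sup>2))"

text \<open>Any two points are joined by a horizontal curve, so this is the infimum of a nonempty set
  of nonnegative reals.\<close>

definition control_dist :: "heis \<Rightarrow> heis \<Rightarrow> real" where
  "control_dist P Q =
    Inf {horizontal_length \<alpha> \<beta> a b | \<alpha> \<beta> \<gamma> a b.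
      horizontal_curve \<alpha> \<beta> \<gamma> a b \<and> \<gamma> \<alpha> = P \<and> \<gamma> \<beta> = Q}"

definition heis_biLipschitz :: "real \<Rightarrow> (heis \<Rightarrow> heis) \<Rightarrow> bool" where
  "heis_biLipschitz L f \<longleftrightarrow>
    (\<forall>P Q. inverse L * control_dist P Q \<le> control_dist (f P) (f Q) \<and>
           control_dist (f P) (f Q) \<le> L * control_dist P Q)"

end

theory Submission
  imports Defs
begin

text \<open>Write \<open>(w; t)\<close> for \<open>P\<inverse> \<cdot> Q\<close>. The Koranyi gauge gives \<open>\<bar>w\<bar>\<^sup>4 + t\<^sup>2 \<le> d(P, Q)\<^sup>4\<close>, and a path of two
  segments gives \<open>d(P, Q)\<^sup>2 \<le> \<bar>w\<bar>\<^sup>2 + t\<^sup>2 / \<bar>w\<bar>\<^sup>2\<close>; these two bounds carry the argument.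

  A point moved vertically by \<open>O(1)\<close> changes its distance to a point at distance \<open>M\<close> only by \<open>O(1/M)\<close>.
  Looking back along the image of a line from distance \<open>M = \<epsilon>\<^bsup>-1/2\<^esup>\<close>, this shows that \<open>f\<close> maps a
  horizontal unit vector to a point \<open>(w; t)\<close> with \<open>\<bar>w\<bar> \<ge> 1 - O(\<epsilon>\<^bsup>1/2\<^esup>)\<close>, hence \<open>t = O(\<epsilon>\<^bsup>1/4\<^esup>)\<close>. Now let
  \<open>(W; T)\<close> be the image of \<open>(M u; 0)\<close> with \<open>M = \<epsilon>\<^bsup>-1/4\<^esup>\<close>. Comparing squared distances to it shows that the
  planar part \<open>z'\<close> of \<open>f(z; 0)\<close> satisfies \<open>(W / M) \<bullet> z' = u \<bullet> z + O(\<epsilon>\<^bsup>1/4\<^esup>)\<close>. The vectors \<open>W / M\<close> for the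
  two coordinate directions are orthonormal up to \<open>O(\<epsilon>\<^bsup>1/8\<^esup>)\<close>, so \<open>z'\<close> is within \<open>O(\<epsilon>\<^bsup>1/8\<^esup>)\<close> of \<open>A z\<close>, and
  passing to \<open>d\<close> costs a square root.\<close>

section \<open>Absolutely continuous functions\<close>

text \<open>The exponents come from balances of errors. The scale \<epsilon>^(-1/2) equalises the
  Lipschitz error \<epsilon> M over a length M and the cost 1/M of a vertical move. The height of
  the image of \<open>(M *\<^sub>R u, 0)\<close> is of order \<epsilon>^(1/4) M^2 and enters the
  squared distance through its square divided by M^2; this stays bounded up to M of order
  \<epsilon>^(-1/4), where the Lipschitz error \<epsilon> M^2 is even small, and dividing by M
  leaves \<epsilon>^(1/4). Near-orthogonality loses a root, because two vectors of norm about 1 with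
  inner product 1 - O(\<eta>) are only within O(sqrt \<eta>) of each other. Writing
  \<open>\<epsilon> = \<eta> ^ 4\<close> and \<open>\<eta> = \<mu>\<^sup>2\<close> avoids fractional
  powers.

  The obstacle is that the image of a line could a priori run almost vertically, and a vertical move
  is cheap only along a piece with large planar displacement; such a piece has to be found before
  the line can be used for a detour.

  Lengths are defined through almost-everywhere derivatives, so the lower bound by the gauge rests
  on a fundamental theorem of calculus for absolutely continuous functions.\<close>

definition interval_family :: "real \<Rightarrow> real \<Rightarrow> 'i set \<Rightarrow> ('i \<Rightarrow> real) \<Rightarrow> ('i \<Rightarrow> real) \<Rightarrow> bool" where
  "interval_family \<alpha> \<beta> I u v \<longleftrightarrow> finite I \<and>
    (\<forall>i\<in>I. \<alpha> \<le> u i \<and> u i \<le> v i \<and> v i \<le> \<beta>) \<and>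
    (\<forall>i\<in>I. \<forall>j\<in>I. i \<noteq> j \<longrightarrow> {u i<..<v i} \<inter> {u j<..<v j} = {})"

lemma abs_continuous_on_interval_iff:
  "abs_continuous_on_interval \<alpha> \<beta> g \<longleftrightarrow>
    (\<forall>e>0. \<exists>\<delta>>0. \<forall>D. interval_family \<alpha> \<beta> D fst snd \<and> (\<Sum>i\<in>D. snd i - fst i) < \<delta> \<longrightarrow>
      (\<Sum>i\<in>D. dist (g (fst i)) (g (snd i))) < e)"
  unfolding abs_continuous_on_interval_def interval_family_def pairwise_def case_prod_unfold conj_assoc
  by (rule refl)

text \<open>Sums over tagged divisions and over clipped intervals carry other indices than endpoint
  pairs. By disjointness, equal pairs with different indices can only be degenerate; once the
  intervals of length zero are discarded, which contribute nothing to either sum, the passage to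
  pairs is injective.\<close>

lemma abs_continuous_on_interval_family:
  assumes "abs_continuous_on_interval \<alpha> \<beta> g" and "e > 0"
  shows "\<exists>\<delta>>0. \<forall>(I :: 'i set) u v. interval_family \<alpha> \<beta> I u v \<and> (\<Sum>i\<in>I. v i - u i) < \<delta> \<longrightarrow>
      (\<Sum>i\<in>I. dist (g (u i)) (g (v i))) < e"
proof -
  obtain \<delta> where "\<delta> > 0" and \<delta>: "\<forall>D. interval_family \<alpha> \<beta> D fst snd \<and> (\<Sum>i\<in>D. snd i - fst i) < \<delta> \<longrightarrow>
      (\<Sum>i\<in>D. dist (g (fst i)) (g (snd i))) < e"
    using assms unfolding abs_continuous_on_interval_iff by blast
  have "(\<Sum>i\<in>I. dist (g (u i)) (g (v i))) < e"
    if I: "interval_family \<alpha> \<beta> I u v" and small: "(\<Sum>i\<in>I. v i - u i) < \<delta>"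
    for I :: "'i set" and u v :: "'i \<Rightarrow> real"
  proof -
    have fin: "finite I"
      and bounds: "\<And>i. i \<in> I \<Longrightarrow> \<alpha> \<le> u i \<and> u i \<le> v i \<and> v i \<le> \<beta>"
      and disj: "\<And>i j. \<lbrakk>i \<in> I; j \<in> I; i \<noteq> j\<rbrakk> \<Longrightarrow> {u i<..<v i} \<inter> {u j<..<v j} = {}"
      using I unfolding interval_family_def by blast+
    define I' where "I' = {i \<in> I. u i < v i}"
    have I': "finite I'" "I' \<subseteq> I"
      using fin by (auto simp: I'_def)
    have eq: "u i = v i" if "i \<in> I - I'" for i
      using that bounds[of i] by (auto simp: I'_def)
    have inj: "inj_on (\<lambda>i. (u i, v i)) I'"
    proof (rule inj_onI, rule ccontr)
      fix i j assume *: "i \<in> I'" "j \<in> I'" "(u i, v i) = (u j, v j)" "i \<noteq> j"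
      then have "{u i<..<v i} = {}"
        using disj[of i j] by (auto simp: I'_def)
      with * show False
        by (auto simp: I'_def)
    qed
    have "(\<Sum>i\<in>I. dist (g (u i)) (g (v i))) = (\<Sum>i\<in>I'. dist (g (u i)) (g (v i)))"
      by (rule sum.mono_neutral_right) (use fin I' eq in auto)
    also have "\<dots> = (\<Sum>p\<in>(\<lambda>i. (u i, v i)) ` I'. dist (g (fst p)) (g (snd p)))"
      by (simp add: sum.reindex[OF inj])
    also have "\<dots> < e"
    proof (rule \<delta>[rule_format], intro conjI)
      have "(\<Sum>p\<in>(\<lambda>i. (u i, v i)) ` I'. snd p - fst p) = (\<Sum>i\<in>I'. v i - u i)"
        by (simp add: sum.reindex[OF inj])
      also have "\<dots> = (\<Sum>i\<in>I. v i - u i)"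
        by (rule sum.mono_neutral_left) (use fin I' eq in auto)
      finally show "(\<Sum>p\<in>(\<lambda>i. (u i, v i)) ` I'. snd p - fst p) < \<delta>"
        using small by simp
      have "{u i<..<v i} \<inter> {u j<..<v j} = {}" if "i \<in> I'" "j \<in> I'" "(u i, v i) \<noteq> (u j, v j)" for i j
        using that disj[of i j] I'(2) by blast
      moreover have "\<alpha> \<le> u i \<and> u i \<le> v i \<and> v i \<le> \<beta>" if "i \<in> I'" for i
        using that bounds I'(2) by blast
      ultimately show "interval_family \<alpha> \<beta> ((\<lambda>i. (u i, v i)) ` I') fst snd"
        unfolding interval_family_def ball_simps fst_conv snd_conv using I'(1) by blast
    qed
    finally show ?thesis .
  qed
  with \<open>\<delta> > 0\<close> show ?thesis
    by blast
qed

lemma abs_continuous_on_interval_lipschitz_comp: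
  assumes g: "abs_continuous_on_interval \<alpha> \<beta> g"
    and lip: "\<And>s t. \<lbrakk>s \<in> {\<alpha>..\<beta>}; t \<in> {\<alpha>..\<beta>}\<rbrakk> \<Longrightarrow> dist (h s) (h t) \<le> C * dist (g s) (g t)"
  shows "abs_continuous_on_interval \<alpha> \<beta> h"
  unfolding abs_continuous_on_interval_iff
proof (intro allI impI)
  fix e :: real assume "e > 0"
  \<comment> \<open>\<open>C\<close> may be zero or negative, so it is enlarged before dividing by
    it.\<close>
  define C' where "C' = max C 1"
  have "C' > 0" "C \<le> C'"
    by (auto simp: C'_def)
  then have "e / C' > 0"
    using \<open>e > 0\<close> by simp
  with g obtain \<delta> where "\<delta> > 0" and \<delta>: "\<forall>D. interval_family \<alpha> \<beta> D fst snd \<and> (\<Sum>i\<in>D. snd i - fst i) < \<delta> \<longrightarrow>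
      (\<Sum>i\<in>D. dist (g (fst i)) (g (snd i))) < e / C'"
    unfolding abs_continuous_on_interval_iff by blast
  have "(\<Sum>i\<in>D. dist (h (fst i)) (h (snd i))) < e"
    if D: "interval_family \<alpha> \<beta> D fst snd \<and> (\<Sum>i\<in>D. snd i - fst i) < \<delta>" for D
  proof -
    have "dist (h (fst i)) (h (snd i)) \<le> C' * dist (g (fst i)) (g (snd i))" if "i \<in> D" for i
    proof -
      have "dist (h (fst i)) (h (snd i)) \<le> C * dist (g (fst i)) (g (snd i))"
        using that D unfolding interval_family_def by (intro lip) fastforce+
      also have "\<dots> \<le> C' * dist (g (fst i)) (g (snd i))"
        using \<open>C \<le> C'\<close> by (simp add: mult_right_mono)
      finally show ?thesis .
    qed
    then have "(\<Sum>i\<in>D. dist (h (fst i)) (h (snd i))) \<le> (\<Sum>i\<in>D. C' * dist (g (fst i)) (g (snd i)))"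
      by (rule sum_mono)
    also have "\<dots> = C' * (\<Sum>i\<in>D. dist (g (fst i)) (g (snd i)))"
      by (simp add: sum_distrib_left)
    also have "\<dots> < e"
      using \<delta> D \<open>C' > 0\<close> by (simp add: pos_less_divide_eq mult.commute)
    finally show ?thesis .
  qed
  with \<open>\<delta> > 0\<close> show "\<exists>\<delta>>0. \<forall>D. interval_family \<alpha> \<beta> D fst snd \<and> (\<Sum>i\<in>D. snd i - fst i) < \<delta> \<longrightarrow>
      (\<Sum>i\<in>D. dist (h (fst i)) (h (snd i))) < e"
    by blast
qed

lemma lipschitz_imp_abs_continuous_on_interval:
  fixes h :: "real \<Rightarrow> 'a :: metric_space"
  assumes "\<And>s t. \<lbrakk>s \<in> {\<alpha>..\<beta>}; t \<in> {\<alpha>..\<beta>}\<rbrakk> \<Longrightarrow> dist (h s) (h t) \<le> C * dist s t"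
  shows "abs_continuous_on_interval \<alpha> \<beta> h"
proof (rule abs_continuous_on_interval_lipschitz_comp)
  have "(\<Sum>i\<in>D. dist (fst i) (snd i)) < e"
    if "interval_family \<alpha> \<beta> D fst snd \<and> (\<Sum>i\<in>D. snd i - fst i) < e" for e and D :: "(real \<times> real) set"
  proof -
    have "(\<Sum>i\<in>D. dist (fst i) (snd i)) = (\<Sum>i\<in>D. snd i - fst i)"
      by (rule sum.cong) (use that in \<open>auto simp: dist_real_def interval_family_def\<close>)
    with that show ?thesis
      by simp
  qed
  then show "abs_continuous_on_interval \<alpha> \<beta> (\<lambda>s. s)"
    unfolding abs_continuous_on_interval_iff by blast
qed (use assms in blast)

lemma abs_continuous_on_interval_shift:
  assumes "abs_continuous_on_interval \<alpha> \<beta> g"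
  shows "abs_continuous_on_interval (\<alpha> + c) (\<beta> + c) (\<lambda>s. g (s - c))"
  unfolding abs_continuous_on_interval_iff
proof (intro allI impI)
  fix e :: real assume "e > 0"
  with assms obtain \<delta> where "\<delta> > 0" and
    \<delta>: "\<forall>(I :: (real \<times> real) set) u v. interval_family \<alpha> \<beta> I u v \<and> (\<Sum>i\<in>I. v i - u i) < \<delta> \<longrightarrow>
      (\<Sum>i\<in>I. dist (g (u i)) (g (v i))) < e"
    using abs_continuous_on_interval_family by blast
  have "(\<Sum>i\<in>D. dist (g (fst i - c)) (g (snd i - c))) < e"
    if D: "interval_family (\<alpha> + c) (\<beta> + c) D fst snd \<and> (\<Sum>i\<in>D. snd i - fst i) < \<delta>" for D
  proof (rule \<delta>[rule_format], intro conjI)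
    have "{fst i - c<..<snd i - c} \<inter> {fst j - c<..<snd j - c} = {}" if "i \<in> D" "j \<in> D" "i \<noteq> j" for i j
    proof -
      have "{fst i<..<snd i} \<inter> {fst j<..<snd j} = {}"
        using D that unfolding interval_family_def by blast
      moreover have "x + c \<in> {fst i<..<snd i} \<inter> {fst j<..<snd j}"
        if "x \<in> {fst i - c<..<snd i - c} \<inter> {fst j - c<..<snd j - c}" for x
        using that by auto
      ultimately show ?thesis
        by blast
    qed
    then show "interval_family \<alpha> \<beta> D (\<lambda>i. fst i - c) (\<lambda>i. snd i - c)"
      using D unfolding interval_family_def by (simp add: algebra_simps)
  qed (use D in simp)
  with \<open>\<delta> > 0\<close> show "\<exists>\<delta>>0. \<forall>D. interval_family (\<alpha> + c) (\<beta> + c) D fst snd \<and> (\<Sum>i\<in>D. snd i - fst i) < \<delta> \<longrightarrow>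
      (\<Sum>i\<in>D. dist (g (fst i - c)) (g (snd i - c))) < e"
    by blast
qed

text \<open>Clipping by \<open>min c\<close> and by \<open>max c\<close> splits every interval at
  \<open>c\<close>. Intervals on one side of \<open>c\<close> become degenerate, possibly several of
  them equal, which indexed families tolerate. The triangle inequality matters only for an interval
  that straddles \<open>c\<close>.\<close>

lemma abs_continuous_on_interval_combine:
  assumes g: "abs_continuous_on_interval \<alpha> c g" "abs_continuous_on_interval c \<beta> g"
    and "\<alpha> \<le> c" "c \<le> \<beta>"
  shows "abs_continuous_on_interval \<alpha> \<beta> g"
  unfolding abs_continuous_on_interval_iff
proof (intro allI impI)
  fix e :: real assume "e > 0"
  then have "e / 2 > 0" by simp
  obtain \<delta>1 where "\<delta>1 > 0" and
    \<delta>1: "\<forall>(I :: (real \<times> real) set) u v. interval_family \<alpha> c I u v \<and> (\<Sum>i\<in>I. v i - u i) < \<delta>1 \<longrightarrow>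
      (\<Sum>i\<in>I. dist (g (u i)) (g (v i))) < e / 2"
    using abs_continuous_on_interval_family[OF g(1) \<open>e / 2 > 0\<close>] by blast
  obtain \<delta>2 where "\<delta>2 > 0" and
    \<delta>2: "\<forall>(I :: (real \<times> real) set) u v. interval_family c \<beta> I u v \<and> (\<Sum>i\<in>I. v i - u i) < \<delta>2 \<longrightarrow>
      (\<Sum>i\<in>I. dist (g (u i)) (g (v i))) < e / 2"
    using abs_continuous_on_interval_family[OF g(2) \<open>e / 2 > 0\<close>] by blast
  have "(\<Sum>i\<in>D. dist (g (fst i)) (g (snd i))) < e"
    if D: "interval_family \<alpha> \<beta> D fst snd \<and> (\<Sum>i\<in>D. snd i - fst i) < min \<delta>1 \<delta>2" for D
  proof -
    have fin: "finite D"
      and bd: "\<And>i. i \<in> D \<Longrightarrow> \<alpha> \<le> fst i \<and> fst i \<le> snd i \<and> snd i \<le> \<beta>"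
      and disj: "\<And>i j. \<lbrakk>i \<in> D; j \<in> D; i \<noteq> j\<rbrakk> \<Longrightarrow> {fst i<..<snd i} \<inter> {fst j<..<snd j} = {}"
      and sm: "(\<Sum>i\<in>D. snd i - fst i) < \<delta>1" "(\<Sum>i\<in>D. snd i - fst i) < \<delta>2"
      using D unfolding interval_family_def by auto
    have "(\<Sum>i\<in>D. dist (g (min c (fst i))) (g (min c (snd i)))) < e / 2"
    proof (rule \<delta>1[rule_format], intro conjI)
      have "{min c (fst i)<..<min c (snd i)} \<inter> {min c (fst j)<..<min c (snd j)} = {}"
        if "i \<in> D" "j \<in> D" "i \<noteq> j" for i j
      proof -
        have "{min c (fst i)<..<min c (snd i)} \<subseteq> {fst i<..<snd i}" for i
          by auto
        then show ?thesis
          using disj[OF that] by blast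
      qed
      moreover have "\<alpha> \<le> min c (fst i) \<and> min c (fst i) \<le> min c (snd i) \<and> min c (snd i) \<le> c" if "i \<in> D" for i
        using bd[OF that] \<open>\<alpha> \<le> c\<close> by linarith
      ultimately show "interval_family \<alpha> c D (\<lambda>i. min c (fst i)) (\<lambda>i. min c (snd i))"
        unfolding interval_family_def using fin by blast
      have "(\<Sum>i\<in>D. min c (snd i) - min c (fst i)) \<le> (\<Sum>i\<in>D. snd i - fst i)"
        by (rule sum_mono) (use bd in force)
      with sm show "(\<Sum>i\<in>D. min c (snd i) - min c (fst i)) < \<delta>1"
        by simp
    qed
    moreover have "(\<Sum>i\<in>D. dist (g (max c (fst i))) (g (max c (snd i)))) < e / 2"
    proof (rule \<delta>2[rule_format], intro conjI)
      have "{max c (fst i)<..<max c (snd i)} \<inter> {max c (fst j)<..<max c (snd j)} = {}"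
        if "i \<in> D" "j \<in> D" "i \<noteq> j" for i j
      proof -
        have "{max c (fst i)<..<max c (snd i)} \<subseteq> {fst i<..<snd i}" for i
          by auto
        then show ?thesis
          using disj[OF that] by blast
      qed
      moreover have "c \<le> max c (fst i) \<and> max c (fst i) \<le> max c (snd i) \<and> max c (snd i) \<le> \<beta>" if "i \<in> D" for i
        using bd[OF that] \<open>c \<le> \<beta>\<close> by linarith
      ultimately show "interval_family c \<beta> D (\<lambda>i. max c (fst i)) (\<lambda>i. max c (snd i))"
        unfolding interval_family_def using fin by blast
      have "(\<Sum>i\<in>D. max c (snd i) - max c (fst i)) \<le> (\<Sum>i\<in>D. snd i - fst i)"
        by (rule sum_mono) (use bd in force)
      with sm show "(\<Sum>i\<in>D. max c (snd i) - max c (fst i)) < \<delta>2"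
        by simp
    qed
    moreover have "dist (g (fst i)) (g (snd i)) \<le> dist (g (min c (fst i))) (g (min c (snd i)))
        + dist (g (max c (fst i))) (g (max c (snd i)))" if "i \<in> D" for i
    proof -
      consider "snd i \<le> c" | "c \<le> fst i" | "fst i \<le> c" "c \<le> snd i"
        by linarith
      then show ?thesis
        using bd[OF that] by cases (simp_all add: min_absorb1 min_absorb2 max_absorb1 max_absorb2 dist_triangle)
    qed
    then have "(\<Sum>i\<in>D. dist (g (fst i)) (g (snd i))) \<le> (\<Sum>i\<in>D. dist (g (min c (fst i))) (g (min c (snd i)))
        + dist (g (max c (fst i))) (g (max c (snd i))))"
      by (rule sum_mono)
    ultimately show ?thesis
      by (simp add: sum.distrib)
  qed
  moreover have "min \<delta>1 \<delta>2 > 0"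
    using \<open>\<delta>1 > 0\<close> \<open>\<delta>2 > 0\<close> by simp
  ultimately show "\<exists>\<delta>>0. \<forall>D. interval_family \<alpha> \<beta> D fst snd \<and> (\<Sum>i\<in>D. snd i - fst i) < \<delta> \<longrightarrow>
      (\<Sum>i\<in>D. dist (g (fst i)) (g (snd i))) < e"
    by blast
qed

section \<open>Fundamental theorem of calculus for absolutely continuous functions\<close>

lemma tagged_partial_division_sum_content_le:
  fixes p :: "(real \<times> real set) set"
  assumes p: "p tagged_division_of {a..b}" and q: "q \<subseteq> p" and U: "U \<in> lmeasurable"
    and sub: "\<And>x K. (x, K) \<in> q \<Longrightarrow> K \<subseteq> U"
  shows "(\<Sum>(x, K)\<in>q. Sup K - Inf K) \<le> measure lebesgue U"
proof -
  have fin: "finite q"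
    using p q finite_subset by blast
  have K: "\<exists>u v. K = {u..v} \<and> u \<le> v" if "(x, K) \<in> q" for x K
    using tagged_division_ofD(2,4)[OF p, of x K] that q by fastforce
  have eq: "Sup K - Inf K = measure lebesgue (interior K)" if "(x, K) \<in> q" for x K
    using K[OF that] by auto
  \<comment> \<open>Pieces of a division share at most boundary points, so their interiors are
    disjoint and the lengths add up to the measure of the union of the interiors.\<close>
  have "(\<Sum>(x, K)\<in>q. Sup K - Inf K) = (\<Sum>i\<in>q. measure lebesgue (interior (snd i)))"
    by (rule sum.cong) (use eq in auto)
  also have "\<dots> = measure lebesgue (\<Union>i\<in>q. interior (snd i))"
  proof (rule measure_finite_Union[symmetric])
    show "disjoint_family_on (\<lambda>i. interior (snd i)) q"
      using tagged_division_ofD(5)[OF p] q unfolding disjoint_family_on_def by fastforce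
    show "emeasure lebesgue (interior (snd i)) \<noteq> \<infinity>" if "i \<in> q" for i
      using K[of "fst i" "snd i"] that by auto
  qed (use fin in auto)
  also have "\<dots> \<le> measure lebesgue U"
  proof (rule measure_mono_fmeasurable)
    show "(\<Union>i\<in>q. interior (snd i)) \<subseteq> U"
      using sub interior_subset by fastforce
  qed (use U fin in auto)
  finally show ?thesis .
qed

text \<open>Henstock--Kurzweil form of the fundamental theorem: the differentiability points are handled
  as usual, and the intervals tagged in the null set are absorbed by absolute continuity.\<close>

lemma abs_continuous_has_integral:
  fixes g :: "real \<Rightarrow> 'a :: euclidean_space"
  assumes AC: "abs_continuous_on_interval a b g" and "a \<le> b" and E: "negligible E"
    and der: "\<And>s. s \<in> {a..b} - E \<Longrightarrow> (g has_vector_derivative g' s) (at s within {a..b})"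
  shows "(g' has_integral (g b - g a)) {a..b}"
proof -
  \<comment> \<open>\<open>g'\<close> is arbitrary on \<open>E\<close>. With the value 0 there, a
    piece tagged in \<open>E\<close> contributes only its increment of \<open>g\<close>, which
    absolute continuity controls.\<close>
  define f' where "f' = (\<lambda>s. if s \<in> E then 0 else g' s)"
  have "(f' has_integral (g b - g a)) (cbox a b)"
    unfolding has_integral
  proof (intro allI impI)
    fix e0 :: real assume "e0 > 0"
    \<comment> \<open>The other half of \<open>e0\<close> is reserved for the pieces tagged in
      \<open>E\<close>; the \<open>+ 1\<close> covers \<open>a = b\<close>.\<close>
    define e where "e = e0 / (2 * (b - a + 1))"
    have "e > 0" and e: "e * (b - a) < e0 / 2"
      using \<open>e0 > 0\<close> \<open>a \<le> b\<close> by (auto simp: e_def field_simps)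
    have "\<exists>d>0. x \<in> {a..b} - E \<longrightarrow>
         (\<forall>y\<in>{a..b}. norm (y-x) < d \<longrightarrow> norm (g y - g x - (y-x) *\<^sub>R g' x) \<le> e * norm (y-x))" for x
      using der[of x] \<open>e > 0\<close> unfolding has_vector_derivative_def has_derivative_within_alt
      by (cases "x \<in> {a..b} - E") (blast, meson zero_less_one)
    then obtain d where d0: "\<And>x. 0 < d x" and d: "\<And>x y. \<lbrakk>x \<in> {a..b} - E; y \<in> {a..b}; norm (y-x) < d x\<rbrakk>
             \<Longrightarrow> norm (g y - g x - (y-x) *\<^sub>R g' x) \<le> e * norm (y-x)"
      by metis
    have "e0 / 2 > 0"
      using \<open>e0 > 0\<close> by simp
    from abs_continuous_on_interval_family[OF AC this]
    obtain \<delta> where "\<delta> > 0" and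
      \<delta>: "\<forall>(I :: (real \<times> real set) set) u v. interval_family a b I u v \<and> (\<Sum>i\<in>I. v i - u i) < \<delta> \<longrightarrow>
        (\<Sum>i\<in>I. dist (g (u i)) (g (v i))) < e0 / 2"
      by blast
    have "E \<in> sets lebesgue"
      using E negligible_imp_sets by blast
    then obtain U where U: "open U" "E \<subseteq> U" "(U - E) \<in> lmeasurable" "emeasure lebesgue (U - E) < ennreal \<delta>"
      using sets_lebesgue_outer_open \<open>\<delta> > 0\<close> by metis
    have "U = (U - E) \<union> E"
      using U(2) by blast
    then have lmU: "U \<in> lmeasurable"
      using U(3) E by (metis fmeasurable.Un negligible_imp_measurable)
    have "measure lebesgue U = measure lebesgue (U - E)"
      using E lmU by (simp add: measure_Diff_null_set negligible_iff_null_sets)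
    also have "\<dots> < \<delta>"
      using U(3,4) \<open>\<delta> > 0\<close> by (simp add: emeasure_eq_measure2 ennreal_less_iff)
    finally have mU: "measure lebesgue U < \<delta>" .
    \<comment> \<open>Pieces tagged in \<open>E\<close> are forced into \<open>U\<close>, so their
      total length is below \<open>\<delta>\<close>; elsewhere the radius comes from
      differentiability.\<close>
    define G where "G = (\<lambda>x. if x \<in> E then U else ball x (d x))"
    have "norm ((\<Sum>(x, K)\<in>p. measure lborel K *\<^sub>R f' x) - (g b - g a)) < e0"
      if p: "p tagged_division_of (cbox a b)" and fine: "G fine p" for p
    proof -
      have p': "p tagged_division_of {a..b}"
        using p by simp
      have finp: "finite p"
        using p by blast
      define q where "q = {i \<in> p. fst i \<in> E}"
      have q: "q \<subseteq> p" "finite q"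
        using finp by (auto simp: q_def)
      have ba: "b - a = (\<Sum>(x,K)\<in>p. Sup K - Inf K)" "g b - g a = (\<Sum>(x,K)\<in>p. g (Sup K) - g (Inf K))"
        using additive_tagged_division_1[where f= "\<lambda>x. x"] additive_tagged_division_1[where f= g]
            \<open>a \<le> b\<close> p' by auto
      have K: "\<exists>u v. K = {u..v} \<and> u \<le> v \<and> a \<le> u \<and> v \<le> b \<and> x \<in> {u..v}" if "(x, K) \<in> p" for x K
        using tagged_division_ofD(2,3,4)[OF p', of x K] that by fastforce
      let ?t = "\<lambda>(x, K). measure lborel K *\<^sub>R f' x - (g (Sup K) - g (Inf K))"
      have "norm (\<Sum>i\<in>q. ?t i) \<le> (\<Sum>i\<in>q. dist (g (Inf (snd i))) (g (Sup (snd i))))"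
        by (rule sum_norm_le) (auto simp: q_def f'_def dist_norm)
      also have "\<dots> < e0 / 2"
      proof (rule \<delta>[rule_format], intro conjI)
        have "{Inf (snd i)<..<Sup (snd i)} \<inter> {Inf (snd j)<..<Sup (snd j)} = {}" if "i \<in> q" "j \<in> q" "i \<noteq> j" for i j
        proof -
          have "interior (snd i) \<inter> interior (snd j) = {}"
            using tagged_division_ofD(5)[OF p', of "fst i" "snd i" "fst j" "snd j"] q(1) that by auto
          moreover have "{Inf (snd i)<..<Sup (snd i)} \<subseteq> interior (snd i)" if "i \<in> q" for i
          proof -
            obtain u v where "snd i = {u..v}" "u \<le> v"
              using K[of "fst i" "snd i"] q(1) \<open>i \<in> q\<close> by auto
            then show ?thesis
              by simp
          qed
          ultimately show ?thesis
            using that by blast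
        qed
        moreover have "a \<le> Inf (snd i) \<and> Inf (snd i) \<le> Sup (snd i) \<and> Sup (snd i) \<le> b" if "i \<in> q" for i
        proof -
          obtain u v where "snd i = {u..v}" "u \<le> v" "a \<le> u" "v \<le> b"
            using K[of "fst i" "snd i"] q(1) \<open>i \<in> q\<close> by auto
          then show ?thesis
            by simp
        qed
        ultimately show "interval_family a b q (\<lambda>i. Inf (snd i)) (\<lambda>i. Sup (snd i))"
          unfolding interval_family_def using q(2) by blast
        have "(\<Sum>(x, K)\<in>q. Sup K - Inf K) \<le> measure lebesgue U"
          by (rule tagged_partial_division_sum_content_le[OF p' q(1) lmU])
             (use fine in \<open>fastforce simp: q_def G_def fine_def\<close>)
        with mU show "(\<Sum>i\<in>q. Sup (snd i) - Inf (snd i)) < \<delta>"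
          by (simp add: case_prod_unfold)
      qed
      finally have 1: "norm (\<Sum>i\<in>q. ?t i) < e0 / 2" .
      have tag: "norm (?t (x, K)) \<le> e * (Sup K - Inf K)" if xK: "(x, K) \<in> p - q" for x K
      proof -
        have "x \<notin> E"
          using xK by (auto simp: q_def)
        obtain u v where uv: "K = {u..v}" "u \<le> v" "a \<le> u" "v \<le> b" "x \<in> {u..v}"
          using K xK by blast
        have "K \<subseteq> ball x (d x)"
          using fineD[OF fine, of x K] xK \<open>x \<notin> E\<close> by (simp add: G_def)
        moreover have "u \<in> K" "v \<in> K"
          using uv by auto
        ultimately have "u \<in> ball x (d x)" "v \<in> ball x (d x)"
          by blast+
        then have 3: "norm (g u - g x - (u - x) *\<^sub>R g' x) \<le> e * norm (u - x)"
          "norm (g v - g x - (v - x) *\<^sub>R g' x) \<le> e * norm (v - x)"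
          using uv \<open>x \<notin> E\<close> by (intro d; auto simp: dist_real_def)+
        have "(v - u) *\<^sub>R g' x - (g v - g u) = (g u - g x - (u - x) *\<^sub>R g' x) - (g v - g x - (v - x) *\<^sub>R g' x)"
          by (simp add: algebra_simps)
        then have "norm ((v - u) *\<^sub>R g' x - (g v - g u)) \<le>
            norm (g u - g x - (u - x) *\<^sub>R g' x) + norm (g v - g x - (v - x) *\<^sub>R g' x)"
          by (simp only: norm_triangle_ineq4)
        also have "\<dots> \<le> e * norm (u - x) + e * norm (v - x)"
          by (rule add_mono) (fact 3)+
        also have "\<dots> = e * (v - u)"
          using uv by (auto simp: algebra_simps)
        finally show ?thesis
          using uv \<open>x \<notin> E\<close> by (simp add: f'_def)
      qed
      have "norm (\<Sum>i\<in>p - q. ?t i) \<le> (\<Sum>i\<in>p - q. e * (Sup (snd i) - Inf (snd i)))"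
        by (rule sum_norm_le) (use tag in auto)
      also have "\<dots> \<le> (\<Sum>i\<in>p. e * (Sup (snd i) - Inf (snd i)))"
      proof (rule sum_mono2)
        show "0 \<le> e * (Sup (snd i) - Inf (snd i))" if "i \<in> p - (p - q)" for i
          using K[of "fst i" "snd i"] that \<open>e > 0\<close> by auto
      qed (use finp in auto)
      also have "\<dots> = e * (b - a)"
        by (simp add: ba(1) sum_distrib_left case_prod_unfold)
      finally have 2: "norm (\<Sum>i\<in>p - q. ?t i) < e0 / 2"
        using e by simp
      have "(\<Sum>(x, K)\<in>p. measure lborel K *\<^sub>R f' x) - (g b - g a) = (\<Sum>i\<in>p. ?t i)"
        by (simp add: ba(2) case_prod_unfold sum_subtractf)
      also have "\<dots> = (\<Sum>i\<in>p - q. ?t i) + (\<Sum>i\<in>q. ?t i)"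
        by (rule sum.subset_diff[OF q(1) finp])
      finally have 3: "(\<Sum>(x, K)\<in>p. measure lborel K *\<^sub>R f' x) - (g b - g a) =
          (\<Sum>i\<in>p - q. ?t i) + (\<Sum>i\<in>q. ?t i)" .
      show ?thesis
        unfolding 3 by (rule le_less_trans[OF norm_triangle_ineq]) (use 1 2 in linarith)
    qed
    moreover have "gauge G"
      using U(1,2) d0 by (auto simp: gauge_def G_def)
    ultimately show "\<exists>\<gamma>. gauge \<gamma> \<and> (\<forall>\<D>. \<D> tagged_division_of cbox a b \<and> \<gamma> fine \<D> \<longrightarrow>
        norm ((\<Sum>(x, k)\<in>\<D>. measure lborel k *\<^sub>R f' x) - (g b - g a)) < e0)"
      by blast
  qed
  then have "(f' has_integral (g b - g a)) {a..b}"
    by simp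
  then show ?thesis
    by (rule has_integral_spike[OF E, rotated]) (auto simp: f'_def)
qed

text \<open>The fundamental theorem on subintervals turns the sum of
  \<open>norm (integral K g')\<close> over a division into a sum of increments of \<open>g\<close>.
  On an interval shorter than the \<open>\<delta>\<close> belonging to the tolerance 1 this sum
  stays below 1, so the indefinite integral has bounded variation there, which makes a
  Henstock--Kurzweil integrable function absolutely integrable.\<close>

lemma abs_continuous_absolutely_integrable:
  fixes g :: "real \<Rightarrow> 'a :: euclidean_space"
  assumes AC: "abs_continuous_on_interval a b g" and "a \<le> b" and E: "negligible E"
    and der: "\<And>s. s \<in> {a..b} - E \<Longrightarrow> (g has_vector_derivative g' s) (at s within {a..b})"
  shows "g' absolutely_integrable_on {a..b}"
proof -
  have sub: "(g' has_integral (g v - g u)) {u..v}" if "a \<le> u" "u \<le> v" "v \<le> b" for u v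
  proof (rule abs_continuous_has_integral[OF _ _ E])
    have "interval_family a b I p q" if "interval_family u v I p q" for I :: "(real \<times> real) set" and p q
      using that \<open>a \<le> u\<close> \<open>v \<le> b\<close> unfolding interval_family_def by fastforce
    with AC show "abs_continuous_on_interval u v g"
      unfolding abs_continuous_on_interval_iff by meson
    show "(g has_vector_derivative g' s) (at s within {u..v})" if "s \<in> {u..v} - E" for s
      by (rule has_vector_derivative_within_subset[OF der]) (use that \<open>a \<le> u\<close> \<open>v \<le> b\<close> in auto)
  qed (use that in auto)
  obtain \<delta> where "\<delta> > 0" and
    \<delta>: "\<forall>(I :: real set set) u v. interval_family a b I u v \<and> (\<Sum>i\<in>I. v i - u i) < \<delta> \<longrightarrow>
      (\<Sum>i\<in>I. dist (g (u i)) (g (v i))) < 1"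
    using abs_continuous_on_interval_family[OF AC zero_less_one] by blast
  have short: "g' absolutely_integrable_on {u..v}" if "a \<le> u" "u \<le> v" "v \<le> b" "v - u < \<delta>" for u v
  proof -
    have "(\<Sum>K\<in>D. norm (integral K g')) \<le> 1" if D: "D division_of (cbox u v)" for D
    proof -
      have K: "\<exists>p q. K = {p..q} \<and> p \<le> q \<and> u \<le> p \<and> q \<le> v" if "K \<in> D" for K
        using division_ofD(2,3,4)[OF D that] by fastforce
      have "(\<Sum>K\<in>D. norm (integral K g')) = (\<Sum>K\<in>D. dist (g (Inf K)) (g (Sup K)))"
      proof (rule sum.cong[OF refl])
        fix K assume "K \<in> D"
        then obtain p q where K: "K = {p..q}" "p \<le> q" "u \<le> p" "q \<le> v"
          using K by blast
        then have "integral K g' = g q - g p"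
          using sub[of p q] \<open>a \<le> u\<close> \<open>v \<le> b\<close> by (simp add: integral_unique)
        then show "norm (integral K g') = dist (g (Inf K)) (g (Sup K))"
          using K by (simp add: dist_norm norm_minus_commute)
      qed
      also have "\<dots> < 1"
      proof (rule \<delta>[rule_format], intro conjI)
        have "{Inf K<..<Sup K} \<inter> {Inf L<..<Sup L} = {}" if "K \<in> D" "L \<in> D" "K \<noteq> L" for K L
        proof -
          have "interior K \<inter> interior L = {}"
            using division_ofD(5)[OF D] that by blast
          moreover have "{Inf K<..<Sup K} \<subseteq> interior K" if "K \<in> D" for K
            using K[OF that] by auto
          ultimately show ?thesis
            using that by blast
        qed
        moreover have "a \<le> Inf K \<and> Inf K \<le> Sup K \<and> Sup K \<le> b" if "K \<in> D" for K
          using K[OF that] \<open>a \<le> u\<close> \<open>v \<le> b\<close> by auto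
        ultimately show "interval_family a b D Inf Sup"
          unfolding interval_family_def using division_ofD(1)[OF D] by blast
        have "(\<Sum>K\<in>D. Sup K - Inf K) = (\<Sum>K\<in>D. measure lborel K)"
          by (rule sum.cong) (use K in fastforce)+
        also have "\<dots> = v - u"
          using additive_content_division[OF D] \<open>u \<le> v\<close> by simp
        finally show "(\<Sum>K\<in>D. Sup K - Inf K) < \<delta>"
          using \<open>v - u < \<delta>\<close> by simp
      qed
      finally show ?thesis
        by simp
    qed
    moreover have "g' integrable_on cbox u v"
      using sub[OF that(1-3)] by (auto simp: integrable_on_def)
    ultimately have "g' absolutely_integrable_on cbox u v"
      by (intro bounded_variation_absolutely_integrable_interval)
    then show ?thesis
      by simp
  qed
  \<comment> \<open>Steps of \<open>\<delta> / 2\<close> keep each new piece strictly shorter than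
    \<open>\<delta>\<close>; clipping at \<open>b\<close> lets the induction run past the
    end.\<close>
  have step: "g' absolutely_integrable_on {a..min b (a + real n * (\<delta> / 2))}" for n
  proof (induction n)
    case 0
    show ?case
      using short[of a a] \<open>a \<le> b\<close> \<open>\<delta> > 0\<close> by (simp add: min_absorb2)
  next
    case (Suc n)
    let ?u = "min b (a + real n * (\<delta> / 2))" and ?v = "min b (a + real (Suc n) * (\<delta> / 2))"
    have "real (Suc n) * (\<delta> / 2) = real n * (\<delta> / 2) + \<delta> / 2" "0 \<le> real n * (\<delta> / 2)"
      using \<open>\<delta> > 0\<close> by (auto simp: algebra_simps)
    then have uv: "a \<le> ?u" "?u \<le> ?v" "?v \<le> b" "?v - ?u < \<delta>"
      using \<open>a \<le> b\<close> \<open>\<delta> > 0\<close> by linarith+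
    then have "g' absolutely_integrable_on ({a..?u} \<union> {?u..?v})"
      by (intro set_integrable_Un Suc short) auto
    also have "{a..?u} \<union> {?u..?v} = {a..?v}"
      using uv(1,2) by (rule ivl_disj_un_two_touch(4))
    finally show ?case .
  qed
  obtain n where "(b - a) / (\<delta> / 2) < real n"
    using reals_Archimedean2 by blast
  then have "b \<le> a + real n * (\<delta> / 2)"
    using \<open>\<delta> > 0\<close> by (simp add: field_simps)
  then show ?thesis
    using step[of n] by (simp add: min_absorb1)
qed

section \<open>Horizontal curves\<close>

text \<open>Horizontal curves with an exceptional null set in place of \<open>AE\<close> and the Henstock--Kurzweil
  integral in place of the Lebesgue integral: measurability and integrability of the controls then
  follow from absolute continuity and need no care when curves are transformed.\<close>

definition horizontal_join :: "heis \<Rightarrow> heis \<Rightarrow> real \<Rightarrow> bool" where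
  "horizontal_join P Q l \<longleftrightarrow> (\<exists>\<alpha> \<beta> \<gamma> E a b. \<alpha> < \<beta> \<and> abs_continuous_on_interval \<alpha> \<beta> \<gamma> \<and> negligible E \<and>
    (\<forall>s\<in>{\<alpha>..\<beta>} - E. (\<gamma> has_vector_derivative a s *\<^sub>R heis_X (\<gamma> s) + b s *\<^sub>R heis_Y (\<gamma> s))
      (at s within {\<alpha>..\<beta>})) \<and>
    ((\<lambda>s. sqrt ((a s)\<^sup>2 + (b s)\<^sup>2)) has_integral l) {\<alpha>..\<beta>} \<and> \<gamma> \<alpha> = P \<and> \<gamma> \<beta> = Q)"

lemma norm_real_2: "norm (z :: real ^ 2) = sqrt ((z $ 1)\<^sup>2 + (z $ 2)\<^sup>2)"
  by (simp add: norm_vec_def L2_set_def sum_2)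

lemma fst_heis_fields: "fst (a *\<^sub>R heis_X P + b *\<^sub>R heis_Y P) = vector [a, b]"
  by (simp add: heis_X_def heis_Y_def vec_eq_iff forall_2)

text \<open>The planar part of \<open>\<gamma>\<close> is absolutely continuous with derivative
  \<open>(a, b)\<close>, so integrability of the controls comes from the curve itself.\<close>

lemma horizontal_controls_integrable:
  assumes "\<alpha> < \<beta>" and AC: "abs_continuous_on_interval \<alpha> \<beta> \<gamma>" and E: "negligible E"
    and der: "\<And>s. s \<in> {\<alpha>..\<beta>} - E \<Longrightarrow> (\<gamma> has_vector_derivative a s *\<^sub>R heis_X (\<gamma> s) + b s *\<^sub>R heis_Y (\<gamma> s))
      (at s within {\<alpha>..\<beta>})"
  shows "(\<lambda>s. vector [a s, b s] :: real ^ 2) absolutely_integrable_on {\<alpha>..\<beta>}"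
proof (rule abs_continuous_absolutely_integrable[OF _ _ E])
  show "abs_continuous_on_interval \<alpha> \<beta> (\<lambda>s. fst (\<gamma> s))"
    by (rule abs_continuous_on_interval_lipschitz_comp[OF AC, where C = 1]) (simp add: dist_fst_le)
  fix s assume "s \<in> {\<alpha>..\<beta>} - E"
  from bounded_linear.has_vector_derivative[OF bounded_linear_fst der[OF this]]
  show "((\<lambda>s. fst (\<gamma> s)) has_vector_derivative (vector [a s, b s])) (at s within {\<alpha>..\<beta>})"
    by (simp only: fst_heis_fields)
qed (use \<open>\<alpha> < \<beta>\<close> in simp)

text \<open>Absolute integrability of the controls makes the two integrals for the length agree and
  supplies the measurability that \<open>horizontal_curve\<close> demands. Hence both infima run
  over the same set of lengths.\<close>

lemma control_dist_eq: "control_dist P Q = Inf {l. horizontal_join P Q l}"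
proof -
  have "horizontal_join P Q (horizontal_length \<alpha> \<beta> a b)"
    if curve: "horizontal_curve \<alpha> \<beta> \<gamma> a b" and "\<gamma> \<alpha> = P" "\<gamma> \<beta> = Q" for \<alpha> \<beta> \<gamma> a b
  proof -
    have "\<alpha> < \<beta>" and AC: "abs_continuous_on_interval \<alpha> \<beta> \<gamma>"
      using curve by (auto simp: horizontal_curve_def)
    have "AE s in lebesgue. s \<in> {\<alpha>..\<beta>} \<longrightarrow>
      (\<gamma> has_vector_derivative a s *\<^sub>R heis_X (\<gamma> s) + b s *\<^sub>R heis_Y (\<gamma> s)) (at s within {\<alpha>..\<beta>})"
      using curve by (simp add: horizontal_curve_def AE_restrict_space_iff)
    then obtain E where E: "negligible E" and
      der: "\<And>s. s \<in> {\<alpha>..\<beta>} - E \<Longrightarrow> (\<gamma> has_vector_derivative a s *\<^sub>R heis_X (\<gamma> s) + b s *\<^sub>R heis_Y (\<gamma> s))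
        (at s within {\<alpha>..\<beta>})"
      unfolding eventually_ae_filter_negligible by blast
    have "(\<lambda>s. norm (vector [a s, b s] :: real ^ 2)) absolutely_integrable_on {\<alpha>..\<beta>}"
      by (intro absolutely_integrable_norm[unfolded o_def] horizontal_controls_integrable[OF \<open>\<alpha> < \<beta>\<close> AC E der])
    then have "(\<lambda>s. sqrt ((a s)\<^sup>2 + (b s)\<^sup>2)) absolutely_integrable_on {\<alpha>..\<beta>}"
      by (simp add: norm_real_2)
    then have "((\<lambda>s. sqrt ((a s)\<^sup>2 + (b s)\<^sup>2)) has_integral (horizontal_length \<alpha> \<beta> a b)) {\<alpha>..\<beta>}"
      unfolding horizontal_length_def
      by (intro has_integral_integral_lebesgue_on) (auto simp: set_integrable_def integrable_restrict_space)
    with \<open>\<alpha> < \<beta>\<close> AC E der that(2,3) show ?thesis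
      unfolding horizontal_join_def by blast
  qed
  moreover have "\<exists>\<alpha> \<beta> \<gamma> a b. l = horizontal_length \<alpha> \<beta> a b \<and> horizontal_curve \<alpha> \<beta> \<gamma> a b \<and> \<gamma> \<alpha> = P \<and> \<gamma> \<beta> = Q"
    if join: "horizontal_join P Q l" for l
  proof -
    obtain \<alpha> \<beta> \<gamma> E a b where "\<alpha> < \<beta>" and AC: "abs_continuous_on_interval \<alpha> \<beta> \<gamma>" and E: "negligible E" and
      der: "\<And>s. s \<in> {\<alpha>..\<beta>} - E \<Longrightarrow> (\<gamma> has_vector_derivative a s *\<^sub>R heis_X (\<gamma> s) + b s *\<^sub>R heis_Y (\<gamma> s))
        (at s within {\<alpha>..\<beta>})" and
      int: "((\<lambda>s. sqrt ((a s)\<^sup>2 + (b s)\<^sup>2)) has_integral l) {\<alpha>..\<beta>}" and ends: "\<gamma> \<alpha> = P" "\<gamma> \<beta> = Q"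
      using join unfolding horizontal_join_def by blast
    have ab: "(\<lambda>s. vector [a s, b s] :: real ^ 2) absolutely_integrable_on {\<alpha>..\<beta>}"
      by (rule horizontal_controls_integrable[OF \<open>\<alpha> < \<beta>\<close> AC E der])
    then have "(\<lambda>s. (vector [a s, b s] :: real ^ 2) $ i) integrable_on {\<alpha>..\<beta>}" for i
      using integrable_linear[OF _ bounded_linear_vec_nth] unfolding absolutely_integrable_on_def o_def by blast
    from this[of 1] this[of 2] have meas: "a \<in> borel_measurable (lebesgue_on {\<alpha>..\<beta>})"
      "b \<in> borel_measurable (lebesgue_on {\<alpha>..\<beta>})"
      by (simp_all add: integrable_imp_measurable)
    have "AE s in lebesgue. s \<in> {\<alpha>..\<beta>} \<longrightarrow>
      (\<gamma> has_vector_derivative a s *\<^sub>R heis_X (\<gamma> s) + b s *\<^sub>R heis_Y (\<gamma> s)) (at s within {\<alpha>..\<beta>})"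
      unfolding eventually_ae_filter_negligible using E der by blast
    then have "horizontal_curve \<alpha> \<beta> \<gamma> a b"
      using \<open>\<alpha> < \<beta>\<close> AC meas by (simp add: horizontal_curve_def AE_restrict_space_iff)
    moreover have "(\<lambda>s. norm (vector [a s, b s] :: real ^ 2)) absolutely_integrable_on {\<alpha>..\<beta>}"
      using ab by (intro absolutely_integrable_norm[unfolded o_def])
    then have "integrable (lebesgue_on {\<alpha>..\<beta>}) (\<lambda>s. sqrt ((a s)\<^sup>2 + (b s)\<^sup>2))"
      by (simp add: norm_real_2 set_integrable_def integrable_restrict_space)
    then have "horizontal_length \<alpha> \<beta> a b = l"
      unfolding horizontal_length_def using int by (simp add: lebesgue_integral_eq_integral integral_unique)
    ultimately show ?thesis
      using ends by blast
  qed
  ultimately have "(\<exists>\<alpha> \<beta> \<gamma> a b. l = horizontal_length \<alpha> \<beta> a b \<and> horizontal_curve \<alpha> \<beta> \<gamma> a b \<and>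
      \<gamma> \<alpha> = P \<and> \<gamma> \<beta> = Q) \<longleftrightarrow> horizontal_join P Q l" for l
    by - (rule iffI, elim exE conjE, simp, simp)
  then show ?thesis
    by (simp only: control_dist_def)
qed

section \<open>Concatenation and affine images of horizontal curves\<close>

lemma horizontal_join_trans:
  assumes PQ: "horizontal_join P Q l" and QR: "horizontal_join Q R m"
  shows "horizontal_join P R (l + m)"
proof -
  obtain \<alpha> \<beta> \<gamma> E a b where "\<alpha> < \<beta>" and AC: "abs_continuous_on_interval \<alpha> \<beta> \<gamma>" and E: "negligible E" and
    der: "\<And>s. s \<in> {\<alpha>..\<beta>} - E \<Longrightarrow> (\<gamma> has_vector_derivative a s *\<^sub>R heis_X (\<gamma> s) + b s *\<^sub>R heis_Y (\<gamma> s))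
      (at s within {\<alpha>..\<beta>})" and
    int: "((\<lambda>s. sqrt ((a s)\<^sup>2 + (b s)\<^sup>2)) has_integral l) {\<alpha>..\<beta>}" and ends: "\<gamma> \<alpha> = P" "\<gamma> \<beta> = Q"
    using PQ unfolding horizontal_join_def by blast
  obtain \<alpha>0 \<beta>0 \<gamma>0 E0 a0 b0 where "\<alpha>0 < \<beta>0" and AC0: "abs_continuous_on_interval \<alpha>0 \<beta>0 \<gamma>0" and E0: "negligible E0" and
    der0: "\<And>s. s \<in> {\<alpha>0..\<beta>0} - E0 \<Longrightarrow> (\<gamma>0 has_vector_derivative a0 s *\<^sub>R heis_X (\<gamma>0 s) + b0 s *\<^sub>R heis_Y (\<gamma>0 s))
      (at s within {\<alpha>0..\<beta>0})" and
    int0: "((\<lambda>s. sqrt ((a0 s)\<^sup>2 + (b0 s)\<^sup>2)) has_integral m) {\<alpha>0..\<beta>0}" and ends0: "\<gamma>0 \<alpha>0 = Q" "\<gamma>0 \<beta>0 = R"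
    using QR unfolding horizontal_join_def by blast
  define c where "c = \<beta> - \<alpha>0"
  define \<beta>' where "\<beta>' = \<beta>0 + c"
  define \<gamma>' where "\<gamma>' = (\<lambda>s. if s \<le> \<beta> then \<gamma> s else \<gamma>0 (s - c))"
  define a' where "a' = (\<lambda>s. if s \<le> \<beta> then a s else a0 (s - c))"
  define b' where "b' = (\<lambda>s. if s \<le> \<beta> then b s else b0 (s - c))"
  \<comment> \<open>The one-sided derivatives may differ at the junction, so \<open>\<beta>\<close>
    joins the exceptional set.\<close>
  define E' where "E' = insert \<beta> (E \<union> (+) c ` E0)"
  have "\<beta> < \<beta>'" "\<alpha>0 + c = \<beta>"
    using \<open>\<alpha>0 < \<beta>0\<close> by (auto simp: \<beta>'_def c_def)
  have \<gamma>'_right: "\<gamma>' s = \<gamma>0 (s - c)" if "\<beta> \<le> s" for s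
    using that ends ends0 by (auto simp: \<gamma>'_def c_def)
  have "abs_continuous_on_interval \<alpha> \<beta> \<gamma>'"
    by (rule abs_continuous_on_interval_lipschitz_comp[OF AC, where C = 1]) (simp add: \<gamma>'_def)
  moreover have "abs_continuous_on_interval \<beta> \<beta>' \<gamma>'"
  proof (rule abs_continuous_on_interval_lipschitz_comp[where C = 1])
    show "abs_continuous_on_interval \<beta> \<beta>' (\<lambda>s. \<gamma>0 (s - c))"
      using abs_continuous_on_interval_shift[OF AC0, of c] by (simp add: \<beta>'_def \<open>\<alpha>0 + c = \<beta>\<close>)
  qed (simp add: \<gamma>'_right)
  ultimately have AC': "abs_continuous_on_interval \<alpha> \<beta>' \<gamma>'"
    by (rule abs_continuous_on_interval_combine) (use \<open>\<alpha> < \<beta>\<close> \<open>\<beta> < \<beta>'\<close> in auto)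
  have E': "negligible E'"
    unfolding E'_def using E E0 by (simp add: negligible_translation)
  have der': "(\<gamma>' has_vector_derivative a' s *\<^sub>R heis_X (\<gamma>' s) + b' s *\<^sub>R heis_Y (\<gamma>' s))
      (at s within {\<alpha>..\<beta>'})" if s: "s \<in> {\<alpha>..\<beta>'} - E'" for s
  proof (cases "s < \<beta>")
    case True
    have "at s within {\<alpha>..\<beta>'} = at s within {\<alpha>..\<beta>}"
      by (rule at_within_nhd[where S = "{..<\<beta>}"]) (use True \<open>\<beta> < \<beta>'\<close> in auto)
    moreover have "(\<gamma>' has_vector_derivative a s *\<^sub>R heis_X (\<gamma> s) + b s *\<^sub>R heis_Y (\<gamma> s)) (at s within {\<alpha>..\<beta>})"
      by (rule has_vector_derivative_transform[OF _ _ der]) (use s True in \<open>auto simp: \<gamma>'_def E'_def\<close>)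
    ultimately show ?thesis
      using True by (simp add: a'_def b'_def \<gamma>'_def)
  next
    case False
    then have "s > \<beta>"
      using s by (auto simp: E'_def)
    have s0: "s - c \<in> {\<alpha>0..\<beta>0} - E0"
    proof -
      have "s - c \<notin> E0"
      proof
        assume "s - c \<in> E0"
        then have "c + (s - c) \<in> (+) c ` E0"
          by (rule imageI)
        with s show False
          by (simp add: E'_def)
      qed
      with s \<open>s > \<beta>\<close> show ?thesis
        by (auto simp: c_def \<beta>'_def)
    qed
    have "at s within {\<alpha>..\<beta>'} = at s within {\<beta>..\<beta>'}"
      by (rule at_within_nhd[where S = "{\<beta><..}"]) (use \<open>s > \<beta>\<close> \<open>\<alpha> < \<beta>\<close> in auto)
    moreover have "((\<lambda>s. \<gamma>0 (s - c)) has_vector_derivative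
        1 *\<^sub>R (a0 (s - c) *\<^sub>R heis_X (\<gamma>0 (s - c)) + b0 (s - c) *\<^sub>R heis_Y (\<gamma>0 (s - c)))) (at s within {\<beta>..\<beta>'})"
    proof (rule vector_diff_chain_within[of "\<lambda>s. s - c" 1 s "{\<beta>..\<beta>'}" \<gamma>0, unfolded o_def])
      show "((\<lambda>s. s - c) has_vector_derivative 1) (at s within {\<beta>..\<beta>'})"
        by (auto intro!: derivative_eq_intros)
      show "(\<gamma>0 has_vector_derivative a0 (s - c) *\<^sub>R heis_X (\<gamma>0 (s - c)) + b0 (s - c) *\<^sub>R heis_Y (\<gamma>0 (s - c)))
          (at (s - c) within (\<lambda>s. s - c) ` {\<beta>..\<beta>'})"
        by (rule has_vector_derivative_within_subset[OF der0[OF s0]]) (auto simp: c_def \<beta>'_def)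
    qed
    then have "(\<gamma>' has_vector_derivative
        1 *\<^sub>R (a0 (s - c) *\<^sub>R heis_X (\<gamma>0 (s - c)) + b0 (s - c) *\<^sub>R heis_Y (\<gamma>0 (s - c)))) (at s within {\<beta>..\<beta>'})"
      by (rule has_vector_derivative_transform[rotated 2]) (use s \<open>s > \<beta>\<close> \<gamma>'_right in auto)
    ultimately show ?thesis
      using \<open>s > \<beta>\<close> by (simp add: a'_def b'_def \<gamma>'_def)
  qed
  have "((\<lambda>s. sqrt ((a' s)\<^sup>2 + (b' s)\<^sup>2)) has_integral l) {\<alpha>..\<beta>}"
    by (rule has_integral_eq[OF _ int]) (simp add: a'_def b'_def)
  moreover have "((\<lambda>s. sqrt ((a0 (s - c))\<^sup>2 + (b0 (s - c))\<^sup>2)) has_integral m) {\<beta>..\<beta>'}"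
    using has_integral_shift_real_ivl[OF int0, of "- c"] by (simp add: \<open>\<alpha>0 + c = \<beta>\<close> \<beta>'_def)
  then have "((\<lambda>s. sqrt ((a' s)\<^sup>2 + (b' s)\<^sup>2)) has_integral m) {\<beta>..\<beta>'}"
    by (rule has_integral_spike[of "{\<beta>}", rotated 2]) (auto simp: a'_def b'_def)
  ultimately have "((\<lambda>s. sqrt ((a' s)\<^sup>2 + (b' s)\<^sup>2)) has_integral (l + m)) {\<alpha>..\<beta>'}"
    by (rule has_integral_combine[of \<alpha> \<beta> \<beta>', rotated 2]) (use \<open>\<alpha> < \<beta>\<close> \<open>\<beta> < \<beta>'\<close> in auto)
  moreover have "\<gamma>' \<alpha> = P" "\<gamma>' \<beta>' = R"
    using ends ends0 \<open>\<alpha> < \<beta>\<close> \<gamma>'_right[of \<beta>'] \<open>\<beta> < \<beta>'\<close> by (auto simp: \<gamma>'_def \<beta>'_def)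
  moreover have "\<alpha> < \<beta>'"
    using \<open>\<alpha> < \<beta>\<close> \<open>\<beta> < \<beta>'\<close> by simp
  ultimately show ?thesis
    unfolding horizontal_join_def using AC' E' der' by blast
qed

text \<open>The controls are multiplied by \<open>r\<close>, hence so is the length. Left
  translations (\<open>r = 1\<close>, with a shear as linear part) and dilations
  (\<open>C = 0\<close>) are both of this form.\<close>

lemma horizontal_join_affine:
  assumes L: "bounded_linear L" and "r > 0"
    and X: "\<And>P. L (heis_X P) = r *\<^sub>R heis_X (C + L P)"
    and Y: "\<And>P. L (heis_Y P) = r *\<^sub>R heis_Y (C + L P)"
    and join: "horizontal_join P Q l"
  shows "horizontal_join (C + L P) (C + L Q) (r * l)"
proof -
  obtain \<alpha> \<beta> \<gamma> E a b where "\<alpha> < \<beta>" and AC: "abs_continuous_on_interval \<alpha> \<beta> \<gamma>" and E: "negligible E" and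
    der: "\<And>s. s \<in> {\<alpha>..\<beta>} - E \<Longrightarrow> (\<gamma> has_vector_derivative a s *\<^sub>R heis_X (\<gamma> s) + b s *\<^sub>R heis_Y (\<gamma> s))
      (at s within {\<alpha>..\<beta>})" and
    int: "((\<lambda>s. sqrt ((a s)\<^sup>2 + (b s)\<^sup>2)) has_integral l) {\<alpha>..\<beta>}" and ends: "\<gamma> \<alpha> = P" "\<gamma> \<beta> = Q"
    using join unfolding horizontal_join_def by blast
  interpret L: bounded_linear L by fact
  obtain K where K: "\<And>p. norm (L p) \<le> norm p * K"
    using L.bounded by blast
  have AC': "abs_continuous_on_interval \<alpha> \<beta> (\<lambda>s. C + L (\<gamma> s))"
    by (rule abs_continuous_on_interval_lipschitz_comp[OF AC, where C = K])
       (use K in \<open>simp add: dist_norm mult.commute flip: L.diff\<close>)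
  have der': "((\<lambda>s. C + L (\<gamma> s)) has_vector_derivative
      (r * a s) *\<^sub>R heis_X (C + L (\<gamma> s)) + (r * b s) *\<^sub>R heis_Y (C + L (\<gamma> s))) (at s within {\<alpha>..\<beta>})"
    if s: "s \<in> {\<alpha>..\<beta>} - E" for s
    using has_vector_derivative_add[OF has_vector_derivative_const L.has_vector_derivative[OF der[OF s]], of C]
    by (simp add: L.add L.scaleR X Y mult.commute)
  have "sqrt ((r * a s)\<^sup>2 + (r * b s)\<^sup>2) = r * sqrt ((a s)\<^sup>2 + (b s)\<^sup>2)" for s
    using \<open>r > 0\<close> by (simp add: power_mult_distrib real_sqrt_mult flip: distrib_left)
  then have int': "((\<lambda>s. sqrt ((r * a s)\<^sup>2 + (r * b s)\<^sup>2)) has_integral (r * l)) {\<alpha>..\<beta>}"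
    using has_integral_mult_right[OF int, of r] by simp
  show ?thesis
    unfolding horizontal_join_def
    by (rule exI[of _ \<alpha>], rule exI[of _ \<beta>], rule exI[of _ "\<lambda>s. C + L (\<gamma> s)"], rule exI[of _ E],
        rule exI[of _ "\<lambda>s. r * a s"], rule exI[of _ "\<lambda>s. r * b s"])
       (use \<open>\<alpha> < \<beta>\<close> AC' E der' int' ends in auto)
qed

text \<open>With the constant controls \<open>h $ 1\<close> and \<open>h $ 2\<close>, the vertical
  components of the two fields cancel along a straight line through the origin.\<close>

lemma horizontal_join_segment: "horizontal_join 0 (h, 0) (norm h)"
proof -
  define \<gamma> :: "real \<Rightarrow> heis" where "\<gamma> = (\<lambda>s. s *\<^sub>R (h, 0))"
  have "abs_continuous_on_interval 0 1 \<gamma>"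
    by (rule lipschitz_imp_abs_continuous_on_interval[where C = "norm (h, 0::real)"])
       (simp add: \<gamma>_def dist_norm mult.commute flip: scaleR_diff_left)
  moreover have "(\<gamma> has_vector_derivative h $ 1 *\<^sub>R heis_X (\<gamma> s) + h $ 2 *\<^sub>R heis_Y (\<gamma> s)) (at s within {0..1})" for s
  proof -
    have "h $ 1 *\<^sub>R heis_X (\<gamma> s) + h $ 2 *\<^sub>R heis_Y (\<gamma> s) = (h, 0)"
      by (simp add: \<gamma>_def heis_X_def heis_Y_def vec_eq_iff forall_2)
    then show ?thesis
      by (auto simp: \<gamma>_def intro!: derivative_eq_intros)
  qed
  moreover have "((\<lambda>s::real. sqrt ((h $ 1)\<^sup>2 + (h $ 2)\<^sup>2)) has_integral norm h) {0..1}"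
    using has_integral_const_real[of "norm h" 0 1] by (simp add: norm_real_2)
  moreover have "\<gamma> 0 = 0" "\<gamma> 1 = (h, 0)"
    by (simp_all add: \<gamma>_def zero_prod_def)
  ultimately show ?thesis
    unfolding horizontal_join_def using zero_less_one negligible_empty
    by (intro exI[of _ 0] exI[of _ 1] exI[of _ \<gamma>] exI[of _ "{}"] exI[of _ "\<lambda>_. h $ 1"] exI[of _ "\<lambda>_. h $ 2"]) simp
qed

section \<open>The Koranyi gauge along horizontal curves\<close>

lemma abs_continuous_on_interval_imp_bounded:
  fixes g :: "real \<Rightarrow> 'a :: real_normed_vector"
  assumes AC: "abs_continuous_on_interval a b g"
  shows "bounded (g ` {a..b})"
proof -
  have "continuous_on {a..b} g"
    unfolding continuous_on_iff
  proof (intro ballI allI impI)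
    fix x e :: real assume x: "x \<in> {a..b}" and "e > 0"
    obtain \<delta> where "\<delta> > 0" and
      \<delta>: "\<forall>(I :: unit set) u v. interval_family a b I u v \<and> (\<Sum>i\<in>I. v i - u i) < \<delta> \<longrightarrow>
        (\<Sum>i\<in>I. dist (g (u i)) (g (v i))) < e"
      using abs_continuous_on_interval_family[OF AC \<open>e > 0\<close>] by blast
    have "dist (g y) (g x) < e" if "y \<in> {a..b}" "dist y x < \<delta>" for y
    proof -
      have "interval_family a b {()} (\<lambda>_. min x y) (\<lambda>_. max x y)"
        using x that(1) by (auto simp: interval_family_def)
      moreover have "max x y - min x y < \<delta>"
        using that(2) by (auto simp: dist_real_def)
      ultimately have "dist (g (min x y)) (g (max x y)) < e"
        using \<delta>[rule_format, of "{()}" "\<lambda>_. min x y" "\<lambda>_. max x y"] by simp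
      then show ?thesis
        by (auto simp: min_def max_def dist_commute split: if_splits)
    qed
    then show "\<exists>d>0. \<forall>x'\<in>{a..b}. dist x' x < d \<longrightarrow> dist (g x') (g x) < e"
      using \<open>\<delta> > 0\<close> by blast
  qed
  then show ?thesis
    by (intro compact_imp_bounded compact_continuous_image) auto
qed

text \<open>The regularisation \<open>c\<close> makes the Koranyi gauge smooth at the origin.\<close>

definition koranyi_gauge :: "real \<Rightarrow> heis \<Rightarrow> real" where
  "koranyi_gauge c P = sqrt (sqrt (((norm (fst P))\<^sup>2)\<^sup>2 + (snd P)\<^sup>2 + (c\<^sup>2)\<^sup>2))"

lemma sqrt_sqrt_power2_power2: "c \<ge> 0 \<Longrightarrow> sqrt (sqrt ((c\<^sup>2)\<^sup>2)) = c" for c :: real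
  by (simp only: real_sqrt_abs abs_power2 abs_of_nonneg)

lemma koranyi_gauge_ge:
  assumes "c > 0"
  shows "c \<le> koranyi_gauge c P"
proof -
  have "c = sqrt (sqrt ((c\<^sup>2)\<^sup>2))"
    using assms by (simp only: sqrt_sqrt_power2_power2)
  also have "\<dots> \<le> koranyi_gauge c P"
    unfolding koranyi_gauge_def by (intro real_sqrt_le_mono) simp
  finally show ?thesis .
qed

text \<open>The square of the gauge has Lipschitz constant \<open>2 * B + 1\<close> on the ball of
  radius \<open>B\<close>; taking the root divides by a sum of two gauges, which is at least
  \<open>c\<close>. This makes the gauge absolutely continuous along a curve, so that its
  almost-everywhere derivative can be integrated.\<close>

lemma dist_koranyi_gauge_le:
  assumes "c > 0" "norm P \<le> B" "norm Q \<le> B"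
  shows "\<bar>koranyi_gauge c P - koranyi_gauge c Q\<bar> \<le> (2 * B + 1) / c * dist P Q"
proof -
  define N where "N = (\<lambda>P :: heis. norm ((norm (fst P))\<^sup>2, snd P, c\<^sup>2))"
  have N: "koranyi_gauge c P = sqrt (N P)" for P
    by (simp add: koranyi_gauge_def N_def norm_Pair add.assoc)
  have fst: "norm (fst P) \<le> B" "norm (fst Q) \<le> B"
    using assms(2,3) norm_fst_le[of "fst P" "snd P"] norm_fst_le[of "fst Q" "snd Q"] by simp_all
  have "(norm (fst P))\<^sup>2 - (norm (fst Q))\<^sup>2 = (norm (fst P) - norm (fst Q)) * (norm (fst P) + norm (fst Q))"
    by (simp add: power2_eq_square algebra_simps)
  then have "\<bar>(norm (fst P))\<^sup>2 - (norm (fst Q))\<^sup>2\<bar> = \<bar>norm (fst P) - norm (fst Q)\<bar> * (norm (fst P) + norm (fst Q))"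
    by (simp add: abs_mult)
  also have "\<dots> \<le> dist P Q * (2 * B)"
  proof (rule mult_mono)
    show "\<bar>norm (fst P) - norm (fst Q)\<bar> \<le> dist P Q"
      using norm_triangle_ineq3[of "fst P" "fst Q"] dist_fst_le[of P Q] by (simp add: dist_norm)
  qed (use fst in auto)
  finally have 1: "\<bar>(norm (fst P))\<^sup>2 - (norm (fst Q))\<^sup>2\<bar> \<le> 2 * B * dist P Q"
    by (simp add: mult.commute)
  have "\<bar>N P - N Q\<bar> \<le> norm (((norm (fst P))\<^sup>2, snd P, c\<^sup>2) - ((norm (fst Q))\<^sup>2, snd Q, c\<^sup>2))"
    unfolding N_def by (rule norm_triangle_ineq3)
  also have "\<dots> \<le> \<bar>(norm (fst P))\<^sup>2 - (norm (fst Q))\<^sup>2\<bar> + \<bar>snd P - snd Q\<bar>"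
    using norm_Pair_le[of "(norm (fst P))\<^sup>2 - (norm (fst Q))\<^sup>2" "(snd P - snd Q, 0::real)"]
    by (simp add: norm_Pair)
  also have "\<dots> \<le> (2 * B + 1) * dist P Q"
    using 1 dist_snd_le[of P Q] by (simp add: dist_real_def algebra_simps)
  finally have 2: "\<bar>N P - N Q\<bar> \<le> (2 * B + 1) * dist P Q" .
  have "N P \<ge> 0" "N Q \<ge> 0"
    by (auto simp: N_def)
  then have "N P - N Q = (koranyi_gauge c P - koranyi_gauge c Q) * (koranyi_gauge c P + koranyi_gauge c Q)"
    by (simp add: N algebra_simps)
  then have "\<bar>koranyi_gauge c P - koranyi_gauge c Q\<bar> * \<bar>koranyi_gauge c P + koranyi_gauge c Q\<bar> = \<bar>N P - N Q\<bar>"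
    by (simp add: abs_mult)
  moreover have "c \<le> \<bar>koranyi_gauge c P + koranyi_gauge c Q\<bar>"
    using koranyi_gauge_ge[OF \<open>c > 0\<close>, of P] koranyi_gauge_ge[OF \<open>c > 0\<close>, of Q] \<open>c > 0\<close> by linarith
  then have "\<bar>koranyi_gauge c P - koranyi_gauge c Q\<bar> * c \<le>
      \<bar>koranyi_gauge c P - koranyi_gauge c Q\<bar> * \<bar>koranyi_gauge c P + koranyi_gauge c Q\<bar>"
    by (rule mult_left_mono) simp
  ultimately have "\<bar>koranyi_gauge c P - koranyi_gauge c Q\<bar> * c \<le> \<bar>N P - N Q\<bar>"
    by linarith
  with 2 have "\<bar>koranyi_gauge c P - koranyi_gauge c Q\<bar> * c \<le> (2 * B + 1) * dist P Q"
    by linarith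
  then show ?thesis
    using \<open>c > 0\<close> by (simp add: field_simps)
qed

text \<open>The horizontal gradient of the gauge has length at most \<open>1\<close>.\<close>

lemma koranyi_derivative_le:
  fixes x y t a b h :: real
  assumes h: "h > 0" "(x\<^sup>2 + y\<^sup>2)\<^sup>2 + t\<^sup>2 \<le> h ^ 4"
  shows "((x\<^sup>2 + y\<^sup>2) * (x * a + y * b) + t * (a * y - b * x)) / h ^ 3 \<le> sqrt (a\<^sup>2 + b\<^sup>2)"
proof -
  define \<rho> where "\<rho> = x\<^sup>2 + y\<^sup>2"
  have "\<rho> \<ge> 0"
    by (simp add: \<rho>_def)
  have "(h\<^sup>2)\<^sup>2 = h ^ 4"
    by (simp flip: power_mult)
  then have "\<rho>\<^sup>2 \<le> (h\<^sup>2)\<^sup>2"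
    using h(2) zero_le_power2[of t] unfolding \<rho>_def by linarith
  then have \<rho>: "\<rho> \<le> h\<^sup>2"
    by (rule power2_le_imp_le) simp
  \<comment> \<open>The bracket on the left equals
    \<open>a * (\<rho> * x + t * y) + b * (\<rho> * y - t * x)\<close>, so this is the
    Cauchy--Schwarz inequality; its defect is the square supplied.\<close>
  have "(\<rho> * (x * a + y * b) + t * (a * y - b * x))\<^sup>2 \<le> (a\<^sup>2 + b\<^sup>2) * ((\<rho> * x + t * y)\<^sup>2 + (\<rho> * y - t * x)\<^sup>2)"
    using zero_le_power2[of "a * (\<rho> * y - t * x) - b * (\<rho> * x + t * y)"] by (simp add: power2_eq_square algebra_simps)
  also have "(\<rho> * x + t * y)\<^sup>2 + (\<rho> * y - t * x)\<^sup>2 = \<rho> * (\<rho>\<^sup>2 + t\<^sup>2)"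
    by (simp add: \<rho>_def power2_eq_square algebra_simps)
  also have "\<dots> \<le> h\<^sup>2 * h ^ 4"
    using h(2) by (intro mult_mono \<rho>) (auto simp: \<rho>_def)
  also have "\<dots> = (h ^ 3)\<^sup>2"
    by (simp flip: power_add power_mult)
  finally have "(\<rho> * (x * a + y * b) + t * (a * y - b * x))\<^sup>2 \<le> (a\<^sup>2 + b\<^sup>2) * (h ^ 3)\<^sup>2"
    by (simp add: mult_left_mono)
  also have "\<dots> = (sqrt (a\<^sup>2 + b\<^sup>2) * h ^ 3)\<^sup>2"
    by (simp add: power_mult_distrib)
  finally have "\<rho> * (x * a + y * b) + t * (a * y - b * x) \<le> sqrt (a\<^sup>2 + b\<^sup>2) * h ^ 3"
    by (rule power2_le_imp_le) (use h in simp)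
  then show ?thesis
    using h by (simp add: \<rho>_def pos_divide_le_eq)
qed

text \<open>The regularised gauge grows along the curve at most at the rate of its speed.
  Integrating from the value \<open>c\<close> at the origin bounds it by \<open>l + c\<close>, and
  \<open>c\<close> is arbitrary.\<close>

lemma horizontal_join_koranyi:
  assumes join: "horizontal_join 0 P l"
  shows "sqrt (sqrt ((norm (fst P)) ^ 4 + (snd P)\<^sup>2)) \<le> l"
proof -
  obtain \<alpha> \<beta> \<gamma> E a b where "\<alpha> < \<beta>" and AC: "abs_continuous_on_interval \<alpha> \<beta> \<gamma>" and E: "negligible E" and
    der: "\<And>s. s \<in> {\<alpha>..\<beta>} - E \<Longrightarrow> (\<gamma> has_vector_derivative a s *\<^sub>R heis_X (\<gamma> s) + b s *\<^sub>R heis_Y (\<gamma> s))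
      (at s within {\<alpha>..\<beta>})" and
    int: "((\<lambda>s. sqrt ((a s)\<^sup>2 + (b s)\<^sup>2)) has_integral l) {\<alpha>..\<beta>}" and ends: "\<gamma> \<alpha> = 0" "\<gamma> \<beta> = P"
    using join unfolding horizontal_join_def by blast
  obtain B where B: "\<And>s. s \<in> {\<alpha>..\<beta>} \<Longrightarrow> norm (\<gamma> s) \<le> B"
    using abs_continuous_on_interval_imp_bounded[OF AC] unfolding bounded_iff by blast
  have le: "koranyi_gauge c P \<le> l + c" if "c > 0" for c
  proof -
    define x y t where "x = (\<lambda>s. fst (\<gamma> s) $ 1)" and "y = (\<lambda>s. fst (\<gamma> s) $ 2)" and "t = (\<lambda>s. snd (\<gamma> s))"
    define H where "H = (\<lambda>s. koranyi_gauge c (\<gamma> s))"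
    \<comment> \<open>The value that results from differentiating \<open>H s ^ 4\<close>, with
      \<open>2 * (a s * y s - b s * x s)\<close> as derivative of \<open>t\<close>, and dividing by
      \<open>4 * H s ^ 3\<close>.\<close>
    define D where "D = (\<lambda>s. (((x s)\<^sup>2 + (y s)\<^sup>2) * (x s * a s + y s * b s) + t s * (a s * y s - b s * x s)) / H s ^ 3)"
    have H_eq: "H = (\<lambda>s. sqrt (sqrt (((x s)\<^sup>2 + (y s)\<^sup>2)\<^sup>2 + (t s)\<^sup>2 + (c\<^sup>2)\<^sup>2)))"
      by (simp add: H_def koranyi_gauge_def norm_real_2 x_def y_def t_def)
    have H_pos: "H s > 0" for s
      using koranyi_gauge_ge[OF that, of "\<gamma> s"] that by (simp add: H_def)
    have H4: "H s ^ 4 = ((x s)\<^sup>2 + (y s)\<^sup>2)\<^sup>2 + (t s)\<^sup>2 + (c\<^sup>2)\<^sup>2" for s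
    proof -
      have "H s ^ 4 = ((H s)\<^sup>2)\<^sup>2"
        by (simp flip: power_mult)
      then show ?thesis
        by (simp add: H_eq)
    qed
    have "abs_continuous_on_interval \<alpha> \<beta> H"
      by (rule abs_continuous_on_interval_lipschitz_comp[OF AC, where C = "(2 * B + 1) / c"])
         (use dist_koranyi_gauge_le[OF that B B] in \<open>simp add: H_def dist_real_def\<close>)
    moreover have "(H has_vector_derivative D s) (at s within {\<alpha>..\<beta>})" if s: "s \<in> {\<alpha>..\<beta>} - E" for s
    proof -
      have "((\<lambda>s. fst (\<gamma> s)) has_vector_derivative (vector [a s, b s])) (at s within {\<alpha>..\<beta>})"
        using bounded_linear.has_vector_derivative[OF bounded_linear_fst der[OF s]] by (simp only: fst_heis_fields)
      from bounded_linear.has_vector_derivative[OF bounded_linear_vec_nth this]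
      have "((\<lambda>s. fst (\<gamma> s) $ i) has_vector_derivative ((vector [a s, b s] :: real ^ 2) $ i)) (at s within {\<alpha>..\<beta>})" for i .
      from this[of 1] this[of 2]
      have dx: "(x has_real_derivative a s) (at s within {\<alpha>..\<beta>})" and dy: "(y has_real_derivative b s) (at s within {\<alpha>..\<beta>})"
        by (simp_all add: x_def y_def has_real_derivative_iff_has_vector_derivative)
      have dt: "(t has_real_derivative 2 * (a s * y s - b s * x s)) (at s within {\<alpha>..\<beta>})"
        using bounded_linear.has_vector_derivative[OF bounded_linear_snd der[OF s]]
        by (simp add: t_def x_def y_def heis_X_def heis_Y_def has_real_derivative_iff_has_vector_derivative algebra_simps)
      have pos: "((x s)\<^sup>2 + (y s)\<^sup>2)\<^sup>2 + (t s)\<^sup>2 + (c\<^sup>2)\<^sup>2 > 0"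
        using \<open>c > 0\<close> by (intro add_nonneg_pos) auto
      have H2: "sqrt (((x s)\<^sup>2 + (y s)\<^sup>2)\<^sup>2 + (t s)\<^sup>2 + (c\<^sup>2)\<^sup>2) = (H s)\<^sup>2"
        by (simp add: H_eq)
      have "(H has_real_derivative D s) (at s within {\<alpha>..\<beta>})"
        unfolding H_eq
        apply (rule derivative_eq_intros dx dy dt refl | (use pos in simp; fail))+
        unfolding D_def H2 using H_pos[of s] by (simp add: H2 divide_simps power2_eq_square power3_eq_cube) algebra
      then show ?thesis
        by (simp add: has_real_derivative_iff_has_vector_derivative)
    qed
    ultimately have "(D has_integral (H \<beta> - H \<alpha>)) {\<alpha>..\<beta>}"
      using \<open>\<alpha> < \<beta>\<close> by (intro abs_continuous_has_integral[OF _ _ E]) auto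
    then have "H \<beta> - H \<alpha> \<le> l"
    proof (rule has_integral_le[OF _ int])
      fix s
      show "D s \<le> sqrt ((a s)\<^sup>2 + (b s)\<^sup>2)"
        unfolding D_def by (rule koranyi_derivative_le[OF H_pos]) (simp add: H4)
    qed
    moreover have "H \<alpha> = c"
      using that by (simp only: H_def ends koranyi_gauge_def fst_zero snd_zero norm_zero zero_power2 add_0
        sqrt_sqrt_power2_power2 less_imp_le)
    ultimately show ?thesis
      by (simp add: H_def ends)
  qed
  have ge: "sqrt (sqrt ((norm (fst P)) ^ 4 + (snd P)\<^sup>2)) \<le> koranyi_gauge c P" for c
    unfolding koranyi_gauge_def by (intro real_sqrt_le_mono) (simp flip: power_mult)
  \<comment> \<open>The regularisation parameter itself serves as the slack.\<close>
  show ?thesis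
    by (rule field_le_epsilon) (rule order_trans[OF ge le])
qed

section \<open>The control distance\<close>

definition cross2 :: "real ^ 2 \<Rightarrow> real ^ 2 \<Rightarrow> real" where
  "cross2 z w = z $ 1 * w $ 2 - z $ 2 * w $ 1"

text \<open>The vertical coordinate of the product of \<open>- P\<close>, the group inverse of
  \<open>P\<close>, with \<open>Q\<close>; like the planar difference it is invariant under left
  translations.\<close>

definition heis_height :: "heis \<Rightarrow> heis \<Rightarrow> real" where
  "heis_height P Q = snd Q - snd P + 2 * cross2 (fst P) (fst Q)"

definition heis_dilation :: "real \<Rightarrow> heis \<Rightarrow> heis" where
  "heis_dilation r P = (r *\<^sub>R fst P, r\<^sup>2 * snd P)"

lemma heis_mult_cross2: "heis_mult P Q = (fst P + fst Q, snd P + snd Q - 2 * cross2 (fst P) (fst Q))"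
  by (simp add: heis_mult_def cross2_def mult.commute)

lemma cross2_simps:
  "cross2 (z + z') w = cross2 z w + cross2 z' w" "cross2 z (w + w') = cross2 z w + cross2 z w'"
  "cross2 (z - z') w = cross2 z w - cross2 z' w" "cross2 z (w - w') = cross2 z w - cross2 z w'"
  "cross2 (- z) w = - cross2 z w" "cross2 z (- w) = - cross2 z w"
  "cross2 (c *\<^sub>R z) w = c * cross2 z w" "cross2 z (c *\<^sub>R w) = c * cross2 z w"
  "cross2 0 w = 0" "cross2 z 0 = 0" "cross2 z z = 0"
  by (simp_all add: cross2_def algebra_simps)

lemma cross2_commute: "cross2 z w = - cross2 w z"
  by (simp add: cross2_def)

lemma abs_cross2_le: "\<bar>cross2 z w\<bar> \<le> norm z * norm w"
proof -
  have "(cross2 z w)\<^sup>2 \<le> ((z $ 1)\<^sup>2 + (z $ 2)\<^sup>2) * ((w $ 1)\<^sup>2 + (w $ 2)\<^sup>2)"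
    using zero_le_power2[of "z $ 1 * w $ 1 + z $ 2 * w $ 2"]
    by (simp add: cross2_def power2_eq_square algebra_simps)
  also have "\<dots> = (norm z * norm w)\<^sup>2"
    by (simp add: norm_real_2 power_mult_distrib)
  finally show ?thesis
    by (simp add: abs_le_square_iff[symmetric] abs_mult)
qed

lemma heis_mult_left_inverse: "heis_mult (- P) Q = (fst Q - fst P, heis_height P Q)"
  by (simp add: heis_mult_cross2 heis_height_def cross2_simps)

lemma heis_mult_cancel: "heis_mult P (heis_mult (- P) Q) = Q"
  by (simp add: heis_mult_cross2 heis_height_def cross2_simps prod_eq_iff)

lemma heis_mult_0_right [simp]: "heis_mult P 0 = P"
  by (simp add: heis_mult_cross2 cross2_simps)

section \<open>Left translations, dilations and broken lines\<close>

lemma horizontal_join_left_mult: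
  assumes "horizontal_join P Q l"
  shows "horizontal_join (heis_mult A P) (heis_mult A Q) l"
proof -
  define L :: "heis \<Rightarrow> heis" where "L = (\<lambda>P. (fst P, snd P - 2 * cross2 (fst A) (fst P)))"
  have "bounded_linear L"
    by (rule linear_conv_bounded_linear[THEN iffD1], rule linearI)
       (simp_all add: L_def cross2_simps algebra_simps)
  moreover have "L (heis_X P) = 1 *\<^sub>R heis_X (A + L P)" "L (heis_Y P) = 1 *\<^sub>R heis_Y (A + L P)" for P
    by (simp_all add: L_def heis_X_def heis_Y_def cross2_def algebra_simps)
  ultimately have "horizontal_join (A + L P) (A + L Q) (1 * l)"
    using assms by (intro horizontal_join_affine) auto
  moreover have "A + L P = heis_mult A P" for P
    by (simp add: L_def heis_mult_cross2 prod_eq_iff)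
  ultimately show ?thesis
    by simp
qed

lemma horizontal_join_dilation:
  assumes "horizontal_join P Q l" "r > 0"
  shows "horizontal_join (heis_dilation r P) (heis_dilation r Q) (r * l)"
proof -
  have "bounded_linear (heis_dilation r)"
    by (rule linear_conv_bounded_linear[THEN iffD1], rule linearI)
       (simp_all add: heis_dilation_def algebra_simps)
  moreover have "heis_dilation r (heis_X P) = r *\<^sub>R heis_X (0 + heis_dilation r P)"
    "heis_dilation r (heis_Y P) = r *\<^sub>R heis_Y (0 + heis_dilation r P)" for P
    by (simp_all add: heis_dilation_def heis_X_def heis_Y_def power2_eq_square)
  ultimately have "horizontal_join (0 + heis_dilation r P) (0 + heis_dilation r Q) (r * l)"
    using assms by (intro horizontal_join_affine) auto
  then show ?thesis
    by simp
qed

text \<open>The path follows \<open>p\<close> and then \<open>q\<close>, which are half of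
  \<open>w\<close> displaced by the perpendicular vectors \<open>h\<close> and \<open>- h\<close>.
  They have equal length, and their product has height \<open>2 * cross2 w h\<close>, which fixes
  \<open>c\<close>. The excess over \<open>norm w\<close> is quadratic in \<open>t\<close>; the
  comparison of squared distances depends on this.\<close>

lemma horizontal_join_two_segments:
  assumes "w \<noteq> 0"
  shows "horizontal_join 0 (w, t) (sqrt ((norm w)\<^sup>2 + t\<^sup>2 / (norm w)\<^sup>2))"
proof -
  define c where "c = t / (2 * (norm w)\<^sup>2)"
  define h where "h = c *\<^sub>R (vector [- w $ 2, w $ 1] :: real ^ 2)"
  define p q where "p = (1/2) *\<^sub>R w + h" and "q = (1/2) *\<^sub>R w - h"
  have n: "(norm w)\<^sup>2 = (w $ 1)\<^sup>2 + (w $ 2)\<^sup>2"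
    by (simp add: norm_real_2)
  have "norm w > 0"
    using assms by simp
  have h: "h $ 1 = - (c * w $ 2)" "h $ 2 = c * w $ 1"
    by (simp_all add: h_def)
  have "cross2 w h = c * (norm w)\<^sup>2"
    unfolding cross2_def h n by (simp add: algebra_simps power2_eq_square)
  also have "\<dots> = t / 2"
    using \<open>norm w > 0\<close> by (simp add: c_def)
  finally have cr: "cross2 w h = t / 2" .
  have "cross2 p q = - cross2 w h"
    using cross2_commute[of h w] by (simp add: p_def q_def cross2_simps)
  then have "heis_mult (p, 0) (q, 0) = (w, t)"
    using cr by (simp add: heis_mult_cross2 p_def q_def flip: scaleR_add_left)
  moreover have "horizontal_join (p, 0) (heis_mult (p, 0) (q, 0)) (norm q)"
    using horizontal_join_left_mult[OF horizontal_join_segment[of q], of "(p, 0)"] by simp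
  ultimately have "horizontal_join 0 (w, t) (norm p + norm q)"
    using horizontal_join_trans[OF horizontal_join_segment[of p]] by simp
  moreover have "norm p + norm q = sqrt ((norm w)\<^sup>2 + t\<^sup>2 / (norm w)\<^sup>2)"
  proof -
    have inn: "w \<bullet> h = 0"
      by (simp add: inner_vec_def sum_2 h)
    have "(norm h)\<^sup>2 = c\<^sup>2 * (norm w)\<^sup>2"
      unfolding n by (simp add: norm_real_2 h power_mult_distrib distrib_left)
    also have "\<dots> = t\<^sup>2 / (4 * (norm w)\<^sup>2)"
      using \<open>norm w > 0\<close> by (simp add: c_def field_simps power2_eq_square)
    finally have nh: "(norm h)\<^sup>2 = t\<^sup>2 / (4 * (norm w)\<^sup>2)" .
    have "(norm p)\<^sup>2 = (norm w)\<^sup>2 / 4 + t\<^sup>2 / (4 * (norm w)\<^sup>2)"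
      unfolding nh[symmetric] unfolding power2_norm_eq_inner p_def using inn
      by (simp add: inner_add inner_commute[of h w])
    then have p: "norm p = sqrt ((norm w)\<^sup>2 / 4 + t\<^sup>2 / (4 * (norm w)\<^sup>2))"
      by (metis norm_ge_zero real_sqrt_unique)
    have "(norm q)\<^sup>2 = (norm w)\<^sup>2 / 4 + t\<^sup>2 / (4 * (norm w)\<^sup>2)"
      unfolding nh[symmetric] unfolding power2_norm_eq_inner q_def using inn
      by (simp add: inner_diff inner_commute[of h w])
    then have q: "norm q = sqrt ((norm w)\<^sup>2 / 4 + t\<^sup>2 / (4 * (norm w)\<^sup>2))"
      by (metis norm_ge_zero real_sqrt_unique)
    have eq: "(norm w)\<^sup>2 / 4 + t\<^sup>2 / (4 * (norm w)\<^sup>2) = ((norm w)\<^sup>2 + t\<^sup>2 / (norm w)\<^sup>2) / 4"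
      using \<open>norm w > 0\<close> by (simp add: field_simps)
    show ?thesis
      unfolding p q eq by (simp add: real_sqrt_divide)
  qed
  ultimately show ?thesis
    by simp
qed

text \<open>The two-segment bound requires a nonzero planar part. So the path leaves along
  \<open>k\<close>, of length \<open>sqrt \<bar>t\<bar>\<close>, and returns to the vertical axis by
  two segments; the total is \<open>(1 + sqrt 2) * sqrt \<bar>t\<bar>\<close>.\<close>

lemma horizontal_join_vertical:
  obtains l where "horizontal_join 0 (0, t) l" "l \<le> 3 * sqrt \<bar>t\<bar>"
proof (cases "t = 0")
  case True
  then show thesis
    using horizontal_join_segment[of 0] by (intro that[of 0]) auto
next
  case False
  define k :: "real ^ 2" where "k = vector [sqrt \<bar>t\<bar>, 0]"
  have nk: "norm k = sqrt \<bar>t\<bar>" "k \<noteq> 0"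
    using False by (simp_all add: k_def norm_real_2 vec_eq_iff forall_2)
  have "horizontal_join 0 (- k, t) (sqrt ((norm (- k))\<^sup>2 + t\<^sup>2 / (norm (- k))\<^sup>2))"
    using nk by (intro horizontal_join_two_segments) simp
  moreover have "(norm (- k))\<^sup>2 + t\<^sup>2 / (norm (- k))\<^sup>2 = 2 * \<bar>t\<bar>"
    using False by (simp add: nk field_simps power2_eq_square)
  ultimately have "horizontal_join 0 (- k, t) (sqrt (2 * \<bar>t\<bar>))"
    by simp
  from horizontal_join_left_mult[OF this, of "(k, 0)"]
  have "horizontal_join (k, 0) (0, t) (sqrt (2 * \<bar>t\<bar>))"
    by (simp add: heis_mult_cross2 cross2_simps)
  with horizontal_join_trans[OF horizontal_join_segment[of k]]
  have "horizontal_join 0 (0, t) (norm k + sqrt (2 * \<bar>t\<bar>))"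
    by blast
  moreover have "sqrt (2 * \<bar>t\<bar>) \<le> sqrt (4 * \<bar>t\<bar>)"
    by simp
  then have "norm k + sqrt (2 * \<bar>t\<bar>) \<le> 3 * sqrt \<bar>t\<bar>"
    by (simp add: nk real_sqrt_mult)
  ultimately show thesis
    using that by blast
qed

lemma horizontal_join_ball_box:
  obtains l where "horizontal_join P Q l" "l \<le> norm (fst Q - fst P) + 3 * sqrt \<bar>heis_height P Q\<bar>"
proof -
  define w where "w = fst Q - fst P"
  obtain l where l: "horizontal_join 0 (0, heis_height P Q) l" "l \<le> 3 * sqrt \<bar>heis_height P Q\<bar>"
    using horizontal_join_vertical by blast
  have "horizontal_join (w, 0) (w, heis_height P Q) l"
    using horizontal_join_left_mult[OF l(1), of "(w, 0)"] by (simp add: heis_mult_cross2 cross2_simps)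
  then have "horizontal_join 0 (heis_mult (- P) Q) (norm w + l)"
    using horizontal_join_trans[OF horizontal_join_segment[of w]] by (simp add: heis_mult_left_inverse w_def)
  from horizontal_join_left_mult[OF this, of P]
  have "horizontal_join P Q (norm w + l)"
    by (simp add: heis_mult_cancel)
  then show thesis
    using l(2) by (intro that[of "norm w + l"]) (auto simp: w_def)
qed

lemma horizontal_join_nonneg: "horizontal_join P Q l \<Longrightarrow> 0 \<le> l"
  unfolding horizontal_join_def
  by (elim exE conjE, erule has_integral_nonneg) simp

lemma horizontal_join_koranyi_left:
  assumes "horizontal_join P Q l"
  shows "sqrt (sqrt ((norm (fst Q - fst P)) ^ 4 + (heis_height P Q)\<^sup>2)) \<le> l"
proof -
  have "horizontal_join 0 (fst Q - fst P, heis_height P Q) l"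
    using horizontal_join_left_mult[OF assms, of "- P"]
    by (simp add: heis_mult_left_inverse heis_height_def cross2_simps zero_prod_def)
  then show ?thesis
    using horizontal_join_koranyi by fastforce
qed

section \<open>Metric properties and two-sided bounds of the control distance\<close>

lemma control_dist_le: "horizontal_join P Q l \<Longrightarrow> control_dist P Q \<le> l"
  unfolding control_dist_eq
  by (rule cInf_lower) (auto intro!: bdd_belowI[of _ 0] dest: horizontal_join_nonneg)

lemma control_dist_ge:
  assumes "\<And>l. horizontal_join P Q l \<Longrightarrow> x \<le> l"
  shows "x \<le> control_dist P Q"
proof -
  obtain l where "horizontal_join P Q l"
    by (rule horizontal_join_ball_box)
  then have "{l. horizontal_join P Q l} \<noteq> {}"
    by blast
  then show ?thesis
    unfolding control_dist_eq using assms by (intro cInf_greatest) auto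
qed

lemma control_dist_nonneg [simp]: "0 \<le> control_dist P Q"
  by (rule control_dist_ge) (rule horizontal_join_nonneg)

lemma control_dist_approx:
  assumes "e > 0"
  obtains l where "horizontal_join P Q l" "l < control_dist P Q + e"
proof -
  have "\<not> control_dist P Q + e \<le> control_dist P Q"
    using assms by simp
  then show thesis
    using control_dist_ge[of P Q "control_dist P Q + e"] that not_le by blast
qed

lemma control_dist_triangle: "control_dist P R \<le> control_dist P Q + control_dist Q R"
proof (rule field_le_epsilon)
  fix e :: real assume "e > 0"
  then have "e / 2 > 0" by simp
  obtain l where l: "horizontal_join P Q l" "l < control_dist P Q + e / 2"
    using control_dist_approx[OF \<open>e / 2 > 0\<close>] by blast
  obtain m where m: "horizontal_join Q R m" "m < control_dist Q R + e / 2"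
    using control_dist_approx[OF \<open>e / 2 > 0\<close>] by blast
  have "control_dist P R \<le> l + m"
    by (rule control_dist_le[OF horizontal_join_trans[OF l(1) m(1)]])
  then show "control_dist P R \<le> control_dist P Q + control_dist Q R + e"
    using l(2) m(2) by linarith
qed

lemma control_dist_left_mult: "control_dist (heis_mult A P) (heis_mult A Q) \<le> control_dist P Q"
  by (rule control_dist_ge) (intro control_dist_le horizontal_join_left_mult)

lemma control_dist_dilation_le:
  assumes "r > 0"
  shows "control_dist (heis_dilation r P) (heis_dilation r Q) \<le> r * control_dist P Q"
proof -
  have "control_dist (heis_dilation r P) (heis_dilation r Q) / r \<le> control_dist P Q"
  proof (rule control_dist_ge)
    fix l assume "horizontal_join P Q l"
    from control_dist_le[OF horizontal_join_dilation[OF this assms]]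
    show "control_dist (heis_dilation r P) (heis_dilation r Q) / r \<le> l"
      using assms by (simp add: pos_divide_le_eq mult.commute)
  qed
  then show ?thesis
    using assms by (simp add: pos_divide_le_eq mult.commute)
qed

lemma heis_dilation_inverse: "r \<noteq> 0 \<Longrightarrow> heis_dilation (inverse r) (heis_dilation r P) = P"
  by (simp add: heis_dilation_def power_mult_distrib[symmetric] flip: mult.assoc)

lemma control_dist_dilation:
  assumes "r > 0"
  shows "control_dist (heis_dilation r P) (heis_dilation r Q) = r * control_dist P Q"
proof (rule antisym)
  show "control_dist (heis_dilation r P) (heis_dilation r Q) \<le> r * control_dist P Q"
    by (rule control_dist_dilation_le[OF assms])
  have "control_dist P Q \<le> inverse r * control_dist (heis_dilation r P) (heis_dilation r Q)"
    using control_dist_dilation_le[of "inverse r" "heis_dilation r P" "heis_dilation r Q"] assms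
    by (simp add: heis_dilation_inverse)
  then show "r * control_dist P Q \<le> control_dist (heis_dilation r P) (heis_dilation r Q)"
    using assms by (simp add: field_simps)
qed

lemma power4_eq_power2_power2: "x ^ 4 = (x\<^sup>2)\<^sup>2" for x :: "'a :: monoid_mult"
  by (simp flip: power_mult)

lemma control_dist_koranyi:
  "(norm (fst Q - fst P)) ^ 4 + (heis_height P Q)\<^sup>2 \<le> (control_dist P Q) ^ 4"
proof -
  let ?N = "(norm (fst Q - fst P)) ^ 4 + (heis_height P Q)\<^sup>2"
  have "?N \<ge> 0"
    by simp
  have "sqrt (sqrt ?N) \<le> control_dist P Q"
    by (rule control_dist_ge) (rule horizontal_join_koranyi_left)
  then have "(sqrt (sqrt ?N)) ^ 4 \<le> (control_dist P Q) ^ 4"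
    by (rule power_mono) simp
  moreover have "(sqrt (sqrt ?N)) ^ 4 = ((sqrt (sqrt ?N))\<^sup>2)\<^sup>2"
    by (rule power4_eq_power2_power2)
  ultimately show ?thesis
    using \<open>?N \<ge> 0\<close> by simp
qed

lemma norm_fst_diff_le_control_dist: "norm (fst Q - fst P) \<le> control_dist P Q"
proof -
  have "(norm (fst Q - fst P)) ^ 4 \<le> (control_dist P Q) ^ 4"
    using control_dist_koranyi[of Q P] by (smt (verit) zero_le_power2)
  then show ?thesis
    by (rule power_le_imp_le_base[of _ 3, simplified]) simp_all
qed

lemma abs_heis_height_le: "\<bar>heis_height P Q\<bar> \<le> (control_dist P Q)\<^sup>2"
proof -
  have "0 \<le> norm (fst Q - fst P) ^ 4"
    by simp
  then have "(heis_height P Q)\<^sup>2 \<le> ((control_dist P Q)\<^sup>2)\<^sup>2"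
    using control_dist_koranyi[of Q P] unfolding power4_eq_power2_power2[of "control_dist P Q"] by linarith
  then show ?thesis
    using abs_le_square_iff[of "heis_height P Q" "(control_dist P Q)\<^sup>2"] by simp
qed

lemma control_dist_ball_box:
  "control_dist P Q \<le> norm (fst Q - fst P) + 3 * sqrt \<bar>heis_height P Q\<bar>"
proof -
  obtain l where "horizontal_join P Q l" "l \<le> norm (fst Q - fst P) + 3 * sqrt \<bar>heis_height P Q\<bar>"
    by (rule horizontal_join_ball_box)
  then show ?thesis
    using control_dist_le[of P Q l] by linarith
qed

lemma control_dist_two_segments:
  assumes "fst Q \<noteq> fst P"
  shows "(control_dist P Q)\<^sup>2 \<le> (norm (fst Q - fst P))\<^sup>2 + (heis_height P Q)\<^sup>2 / (norm (fst Q - fst P))\<^sup>2"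
proof -
  have "horizontal_join 0 (fst Q - fst P, heis_height P Q)
      (sqrt ((norm (fst Q - fst P))\<^sup>2 + (heis_height P Q)\<^sup>2 / (norm (fst Q - fst P))\<^sup>2))"
    using assms by (intro horizontal_join_two_segments) simp
  from horizontal_join_left_mult[OF this, of P]
  have "control_dist P Q \<le> sqrt ((norm (fst Q - fst P))\<^sup>2 + (heis_height P Q)\<^sup>2 / (norm (fst Q - fst P))\<^sup>2)"
    by (intro control_dist_le) (simp add: heis_mult_cancel flip: heis_mult_left_inverse)
  from power_mono[OF this, of 2] show ?thesis
    by simp
qed

section \<open>Images of horizontal lines\<close>

lemma heis_biLipschitz_le:
  "heis_biLipschitz (1 + \<epsilon>) f \<Longrightarrow> control_dist (f P) (f Q) \<le> (1 + \<epsilon>) * control_dist P Q"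
  unfolding heis_biLipschitz_def by blast

lemma heis_biLipschitz_ge:
  assumes "heis_biLipschitz (1 + \<epsilon>) f" "\<epsilon> > 0"
  shows "(1 - \<epsilon>) * control_dist P Q \<le> control_dist (f P) (f Q)"
proof -
  have "(1 - \<epsilon>) * (1 + \<epsilon>) \<le> 1"
    by (simp add: algebra_simps)
  then have "1 - \<epsilon> \<le> inverse (1 + \<epsilon>)"
    using assms(2) by (simp add: field_simps)
  then have "(1 - \<epsilon>) * control_dist P Q \<le> inverse (1 + \<epsilon>) * control_dist P Q"
    by (rule mult_right_mono) simp
  also have "\<dots> \<le> control_dist (f P) (f Q)"
    using assms(1) unfolding heis_biLipschitz_def by blast
  finally show ?thesis .
qed

lemma control_dist_horizontal:
  assumes "heis_height P Q = 0"
  shows "control_dist P Q = norm (fst Q - fst P)"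
  using control_dist_ball_box[of P Q] norm_fst_diff_le_control_dist[of Q P] assms by simp

section \<open>Vertical detours and almost geodesic chains\<close>

lemma heis_height_trans:
  "heis_height P R = heis_height P Q + heis_height Q R - 2 * cross2 (fst Q - fst P) (fst R - fst Q)"
  by (simp add: heis_height_def cross2_simps cross2_commute[of "fst Q" "fst P"])

text \<open>Translating the middle piece of a broken geodesic by a horizontal \<open>h\<close> and back moves its end
  vertically by an amount proportional to the displacement of that piece; for a long piece this is
  cheap.\<close>

lemma control_dist_vertical_detour:
  assumes "fst B \<noteq> fst A"
  shows "control_dist P (heis_mult (0, t) Q) \<le>
    control_dist P A + control_dist A B + control_dist B Q + \<bar>t\<bar> / (2 * norm (fst B - fst A))"
proof -
  define w where "w = fst B - fst A"
  have "norm w > 0"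
    using assms by (simp add: w_def)
  \<comment> \<open>With \<open>h\<close> perpendicular to \<open>w\<close>, the height
    \<open>4 * \<bar>cross2 h w\<bar>\<close> is the largest possible for the length of
    \<open>h\<close>; \<open>c\<close> makes it equal to \<open>\<bar>t\<bar>\<close>.\<close>
  define c where "c = t / (4 * (norm w)\<^sup>2)"
  define h :: "real ^ 2" where "h = c *\<^sub>R vector [- w $ 2, w $ 1]"
  have h: "h $ 1 = - (c * w $ 2)" "h $ 2 = c * w $ 1"
    by (simp_all add: h_def)
  have nw: "(norm w)\<^sup>2 = (w $ 1)\<^sup>2 + (w $ 2)\<^sup>2"
    by (simp add: norm_real_2)
  have "(norm h)\<^sup>2 = (c * norm w)\<^sup>2"
    unfolding power_mult_distrib nw by (simp add: norm_real_2 h power_mult_distrib distrib_left)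
  then have "norm h = \<bar>c\<bar> * norm w"
    by (metis abs_mult abs_norm_cancel power2_eq_iff_nonneg abs_ge_zero power2_abs)
  then have nh: "2 * norm h = \<bar>t\<bar> / (2 * norm w)"
    using \<open>norm w > 0\<close> by (simp add: c_def power2_eq_square abs_mult field_simps)
  have "cross2 h w = - (c * (norm w)\<^sup>2)"
    unfolding cross2_def h nw by (simp add: algebra_simps power2_eq_square)
  then have cr: "- 4 * cross2 h w = t"
    using \<open>norm w > 0\<close> by (simp add: c_def)
  \<comment> \<open>The vertical coordinate is chosen so that \<open>A\<close> and its translate are
    joined by a horizontal segment. At \<open>B\<close> the mismatch is then
    \<open>- 4 * cross2 h w\<close>, exactly the vertical shift \<open>t\<close>.\<close>
  define G where "G = (h, 4 * cross2 h (fst A))"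
  have "control_dist A (heis_mult G A) \<le> norm h"
    using control_dist_horizontal[of A "heis_mult G A"]
    by (simp add: G_def heis_mult_cross2 heis_height_def cross2_simps cross2_commute[of "fst A" h])
  moreover have "control_dist (heis_mult G A) (heis_mult G B) \<le> control_dist A B"
    by (rule control_dist_left_mult)
  moreover have "control_dist (heis_mult G B) (heis_mult (0, t) B) \<le> norm h"
  proof -
    have "heis_height (heis_mult G B) (heis_mult (0, t) B) = t + 4 * cross2 h w"
      by (simp add: G_def w_def heis_mult_cross2 heis_height_def cross2_simps cross2_commute[of "fst B" h])
    then show ?thesis
      using control_dist_horizontal[of "heis_mult G B" "heis_mult (0, t) B"] cr
      by (simp add: G_def heis_mult_cross2)
  qed
  moreover have "control_dist (heis_mult (0, t) B) (heis_mult (0, t) Q) \<le> control_dist B Q"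
    by (rule control_dist_left_mult)
  ultimately show ?thesis
    using control_dist_triangle[of P "heis_mult (0, t) Q" A]
      control_dist_triangle[of A "heis_mult (0, t) Q" "heis_mult G A"]
      control_dist_triangle[of "heis_mult G A" "heis_mult (0, t) Q" "heis_mult G B"]
      control_dist_triangle[of "heis_mult G B" "heis_mult (0, t) Q" "heis_mult (0, t) B"] nh
    unfolding w_def by linarith
qed

text \<open>A chain of \<open>16\<close> points that stays in a thin vertical tube encloses too little height to be
  almost geodesic.\<close>

lemma almost_geodesic_chain_wide:
  fixes p :: "nat \<Rightarrow> heis"
  assumes "M > 0" and step: "\<And>k. k < 16 \<Longrightarrow> control_dist (p k) (p (Suc k)) \<le> 1001/1000 * (M / 16)"
    and far: "9/10 * M \<le> control_dist (p 0) (p 16)"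
  obtains i j where "i < j" "j \<le> 16" "M / 100 \<le> norm (fst (p j) - fst (p i))"
proof (rule ccontr)
  assume "\<not> thesis"
  then have small: "norm (fst (p j) - fst (p i)) \<le> M / 100" if "i < j" "j \<le> 16" for i j
    using that \<open>\<And>i j. \<lbrakk>i < j; j \<le> 16; M / 100 \<le> norm (fst (p j) - fst (p i))\<rbrakk> \<Longrightarrow> thesis\<close> by force
  \<comment> \<open>Each step has height at most \<open>40 / 10000 * M\<^sup>2\<close>, and the
    cross term of two vectors of length at most \<open>M / 100\<close> adds
    \<open>2 / 10000 * M\<^sup>2\<close>. In general \<open>n\<close> steps give a total height of
    about \<open>M\<^sup>2 / n\<close>, hence a distance of about \<open>3 * M / sqrt n\<close> by
    the ball-box bound; this must fall below \<open>9/10 * M\<close>, and \<open>n = 16\<close>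
    leaves room for the cross terms.\<close>
  have "\<bar>heis_height (p 0) (p k)\<bar> \<le> real k * (42 / 10000 * M\<^sup>2)" if "k \<le> 16" for k
    using that
  proof (induction k)
    case 0
    then show ?case
      by (simp add: heis_height_def cross2_simps)
  next
    case (Suc k)
    have "\<bar>heis_height (p k) (p (Suc k))\<bar> \<le> (control_dist (p k) (p (Suc k)))\<^sup>2"
      by (rule abs_heis_height_le)
    also have "\<dots> \<le> (1001/1000 * (M / 16))\<^sup>2"
      using step[of k] Suc.prems by (intro power_mono) auto
    also have "\<dots> \<le> 40 / 10000 * M\<^sup>2"
      by (simp add: power_mult_distrib power_divide)
    finally have 1: "\<bar>heis_height (p k) (p (Suc k))\<bar> \<le> 40 / 10000 * M\<^sup>2" .
    have "norm (fst (p k) - fst (p 0)) \<le> M / 100"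
      using small[of 0 k] Suc.prems \<open>M > 0\<close> by (cases "k = 0") auto
    moreover have "norm (fst (p (Suc k)) - fst (p k)) \<le> M / 100"
      using small[of k "Suc k"] Suc.prems by auto
    ultimately have "norm (fst (p k) - fst (p 0)) * norm (fst (p (Suc k)) - fst (p k)) \<le> M / 100 * (M / 100)"
      using \<open>M > 0\<close> by (intro mult_mono) auto
    then have "\<bar>cross2 (fst (p k) - fst (p 0)) (fst (p (Suc k)) - fst (p k))\<bar> \<le> M / 100 * (M / 100)"
      using abs_cross2_le order_trans by blast
    then have 2: "\<bar>cross2 (fst (p k) - fst (p 0)) (fst (p (Suc k)) - fst (p k))\<bar> \<le> 1 / 10000 * M\<^sup>2"
      by (simp add: power2_eq_square)
    have "\<bar>heis_height (p 0) (p k)\<bar> \<le> real k * (42 / 10000 * M\<^sup>2)"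
      using Suc by simp
    with 1 2 heis_height_trans[of "p 0" "p (Suc k)" "p k"]
    have "\<bar>heis_height (p 0) (p (Suc k))\<bar> \<le> real k * (42 / 10000 * M\<^sup>2) + 42 / 10000 * M\<^sup>2"
      by linarith
    then show ?case
      by (simp add: algebra_simps)
  qed
  from this[of 16] have "\<bar>heis_height (p 0) (p 16)\<bar> \<le> (27/100 * M)\<^sup>2"
    by (simp add: power_mult_distrib power_divide)
  then have "sqrt \<bar>heis_height (p 0) (p 16)\<bar> \<le> 27/100 * M"
    using \<open>M > 0\<close> by (intro real_le_lsqrt) auto
  then have "control_dist (p 0) (p 16) \<le> M / 100 + 3 * (27/100 * M)"
    using control_dist_ball_box[of "p 0" "p 16"] small[of 0 16] by simp
  with far \<open>M > 0\<close> show False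
    by simp
qed

lemma control_dist_line:
  assumes "norm u = 1"
  shows "control_dist (s *\<^sub>R u, 0) (s' *\<^sub>R u, 0) = \<bar>s' - s\<bar>"
proof -
  have "heis_height (s *\<^sub>R u, 0) (s' *\<^sub>R u, 0) = 0"
    by (simp add: heis_height_def cross2_simps)
  from control_dist_horizontal[OF this] assms show ?thesis
    by (simp flip: scaleR_diff_left)
qed

text \<open>With \<open>x\<close> the image of \<open>(u, 0)\<close>, the point
  \<open>(0, snd x)\<close> is a vertical translate of \<open>q 0\<close>, so the detour bound puts
  it at distance at most \<open>M\<close> from \<open>q (- M)\<close>, up to small errors. But
  \<open>x\<close> is almost \<open>M + 1\<close> away from \<open>q (- M)\<close>, so the
  horizontal segment from \<open>(0, snd x)\<close> to \<open>x\<close>, of length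
  \<open>norm (fst x)\<close>, must make up for almost all of the difference 1.\<close>

lemma biLipschitz_unit_projection:
  assumes f: "heis_biLipschitz (1 + \<epsilon>) f" "f 0 = 0"
    and \<eta>: "\<epsilon> = \<eta> ^ 4" "0 < \<eta>" "\<eta> \<le> 1/1000" and u: "norm u = 1"
  shows "1 - 54 * \<eta>\<^sup>2 \<le> norm (fst (f (u, 0)))"
proof -
  define M where "M = 1 / \<eta>\<^sup>2"
  have "M > 0"
    using \<eta> by (simp add: M_def)
  have "\<epsilon> > 0"
    using \<eta> by simp
  have eM: "\<epsilon> * M = \<eta>\<^sup>2" "1 / M = \<eta>\<^sup>2"
    using \<eta>(2) by (simp_all add: M_def \<eta>(1) power4_eq_power2_power2 power2_eq_square)
  have "\<eta>\<^sup>2 \<le> 1 * (1/1000)"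
    unfolding power2_eq_square using \<eta> by (intro mult_mono) auto
  moreover have "\<epsilon> = \<eta>\<^sup>2 * \<eta>\<^sup>2"
    by (simp add: \<eta>(1))
  moreover have "\<eta>\<^sup>2 * \<eta>\<^sup>2 \<le> \<eta>\<^sup>2 * (1/1000)"
    using calculation(1) by (intro mult_left_mono) auto
  ultimately have e: "\<epsilon> \<le> \<eta>\<^sup>2 / 1000" "\<epsilon> \<le> 1/1000"
    by auto
  define q where "q = (\<lambda>s. f (s *\<^sub>R u, 0))"
  have q_le: "control_dist (q s) (q s') \<le> (1 + \<epsilon>) * \<bar>s' - s\<bar>" for s s'
    using heis_biLipschitz_le[OF f(1)] control_dist_line[OF u] unfolding q_def by metis
  have q_ge: "(1 - \<epsilon>) * \<bar>s' - s\<bar> \<le> control_dist (q s) (q s')" for s s'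
    using heis_biLipschitz_ge[OF f(1) \<open>\<epsilon> > 0\<close>] control_dist_line[OF u] unfolding q_def by metis
  have q0: "q 0 = 0"
    using f(2) by (simp add: q_def zero_prod_def)
  \<comment> \<open>Sixteen equal steps from \<open>- M\<close> to 0: the detour takes place before
    the line reaches \<open>q 0\<close>.\<close>
  define \<tau> where "\<tau> = (\<lambda>k::nat. real k * (M / 16) - M)"
  obtain i j where ij: "i < j" "j \<le> 16" "M / 100 \<le> norm (fst (q (\<tau> j)) - fst (q (\<tau> i)))"
  proof (rule almost_geodesic_chain_wide[of M "\<lambda>k. q (\<tau> k)"])
    show "control_dist (q (\<tau> k)) (q (\<tau> (Suc k))) \<le> 1001/1000 * (M / 16)" if "k < 16" for k
    proof -
      have "\<bar>\<tau> (Suc k) - \<tau> k\<bar> = M / 16"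
        using \<open>M > 0\<close> by (simp add: \<tau>_def algebra_simps)
      then have "control_dist (q (\<tau> k)) (q (\<tau> (Suc k))) \<le> (1 + \<epsilon>) * (M / 16)"
        using q_le by metis
      also have "\<dots> \<le> 1001/1000 * (M / 16)"
        using e \<open>M > 0\<close> by (intro mult_right_mono) auto
      finally show ?thesis .
    qed
    have "9/10 * M \<le> (1 - \<epsilon>) * M"
      using e \<open>M > 0\<close> by (intro mult_right_mono) auto
    also have "\<dots> \<le> control_dist (q (\<tau> 0)) (q (\<tau> 16))"
      using q_ge[of "\<tau> 16" "\<tau> 0"] \<open>M > 0\<close> by (simp add: \<tau>_def)
    finally show "9/10 * M \<le> control_dist (q (\<tau> 0)) (q (\<tau> 16))" .
  qed (use \<open>M > 0\<close> in auto)
  define x where "x = f (u, 0)"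
  have x: "x = q 1"
    by (simp add: x_def q_def)
  have tx: "\<bar>snd x\<bar> \<le> 101/100"
  proof -
    have "control_dist 0 x \<le> 1 + \<epsilon>"
      using q_le[of 0 1] by (simp add: q0 x)
    then have "(control_dist 0 x)\<^sup>2 \<le> (1001/1000)\<^sup>2"
      using e by (intro power_mono) auto
    then show ?thesis
      using abs_heis_height_le[of 0 x] by (simp add: heis_height_def cross2_simps power_divide)
  qed
  have ord: "- M \<le> \<tau> i" "\<tau> i \<le> \<tau> j" "\<tau> j \<le> 0"
  proof -
    show "- M \<le> \<tau> i"
      using \<open>M > 0\<close> by (simp add: \<tau>_def)
    show "\<tau> i \<le> \<tau> j"
      using \<open>M > 0\<close> ij(1) by (simp add: \<tau>_def mult_right_mono)
    have "real j * (M / 16) \<le> 16 * (M / 16)"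
      using \<open>M > 0\<close> ij(2) by (intro mult_right_mono) auto
    then show "\<tau> j \<le> 0"
      by (simp add: \<tau>_def)
  qed
  have "fst (q (\<tau> j)) \<noteq> fst (q (\<tau> i))"
    using ij(3) \<open>M > 0\<close> by auto
  \<comment> \<open>The detour costs at most \<open>51 / M\<close>; the Lipschitz errors add
    \<open>2 * \<epsilon> * M\<close> and a single \<open>\<epsilon>\<close>. As
    \<open>\<epsilon> * M\<close> and \<open>1 / M\<close> both equal \<open>\<eta>\<^sup>2\<close>,
    the total stays below \<open>54 * \<eta>\<^sup>2\<close>.\<close>
  from control_dist_vertical_detour[OF this, of "q (- M)" "snd x" "q 0"]
  have "control_dist (q (- M)) (0, snd x) \<le> control_dist (q (- M)) (q (\<tau> i)) + control_dist (q (\<tau> i)) (q (\<tau> j))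
      + control_dist (q (\<tau> j)) (q 0) + \<bar>snd x\<bar> / (2 * norm (fst (q (\<tau> j)) - fst (q (\<tau> i))))"
    by (simp add: q0)
  also have "\<bar>snd x\<bar> / (2 * norm (fst (q (\<tau> j)) - fst (q (\<tau> i)))) \<le> (101/100) / (2 * (M / 100))"
    using tx ij(3) \<open>M > 0\<close> by (intro frac_le) auto
  also have "(101/100) / (2 * (M / 100)) \<le> 51 * (1 / M)"
    using \<open>M > 0\<close> by (simp add: field_simps)
  also have "control_dist (q (- M)) (q (\<tau> i)) \<le> (1 + \<epsilon>) * (\<tau> i + M)"
    using q_le[of "- M" "\<tau> i"] ord by simp
  also have "control_dist (q (\<tau> i)) (q (\<tau> j)) \<le> (1 + \<epsilon>) * (\<tau> j - \<tau> i)"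
    using q_le[of "\<tau> i" "\<tau> j"] ord by simp
  also have "control_dist (q (\<tau> j)) (q 0) \<le> (1 + \<epsilon>) * (- \<tau> j)"
    using q_le[of "\<tau> j" 0] ord by simp
  finally have "control_dist (q (- M)) (0, snd x) \<le> (1 + \<epsilon>) * M + 51 * \<eta>\<^sup>2"
    by (simp add: eM algebra_simps)
  moreover have "control_dist (0, snd x) x = norm (fst x)"
    using control_dist_horizontal[of "(0, snd x)" x] by (simp add: heis_height_def cross2_simps)
  moreover have "(1 - \<epsilon>) * (1 + M) \<le> control_dist (q (- M)) x"
    using q_ge[of 1 "- M"] \<open>M > 0\<close> by (simp add: x)
  ultimately have "(1 - \<epsilon>) * (1 + M) \<le> (1 + \<epsilon>) * M + 51 * \<eta>\<^sup>2 + norm (fst x)"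
    using control_dist_triangle[of "q (- M)" x "(0, snd x)"] by linarith
  then have "1 - \<epsilon> - 2 * (\<epsilon> * M) - 51 * \<eta>\<^sup>2 \<le> norm (fst x)"
    by (simp add: algebra_simps)
  moreover have "0 \<le> \<eta>\<^sup>2"
    by simp
  ultimately show ?thesis
    using e(1) unfolding eM x_def by linarith
qed

section \<open>Passage to all scales\<close>

lemma heis_dilation_0 [simp]: "heis_dilation r 0 = 0"
  by (simp add: heis_dilation_def zero_prod_def)

text \<open>Dilations multiply \<open>control_dist\<close> by their factor, which conjugation
  cancels. This carries statements at unit scale over to every scale.\<close>

lemma heis_biLipschitz_dilation_conj:
  assumes "heis_biLipschitz L f" "r > 0"
  shows "heis_biLipschitz L (\<lambda>P. heis_dilation (inverse r) (f (heis_dilation r P)))"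
proof -
  have eq: "control_dist P Q = inverse r * control_dist (heis_dilation r P) (heis_dilation r Q)" for P Q
    using control_dist_dilation[of r P Q] \<open>r > 0\<close> by simp
  have "0 < inverse r"
    using \<open>r > 0\<close> by simp
  have "inverse L * control_dist P Q \<le> inverse r * control_dist (f (heis_dilation r P)) (f (heis_dilation r Q))"
    "inverse r * control_dist (f (heis_dilation r P)) (f (heis_dilation r Q)) \<le> L * control_dist P Q" for P Q
  proof -
    have "inverse L * control_dist (heis_dilation r P) (heis_dilation r Q) \<le> control_dist (f (heis_dilation r P)) (f (heis_dilation r Q))"
      "control_dist (f (heis_dilation r P)) (f (heis_dilation r Q)) \<le> L * control_dist (heis_dilation r P) (heis_dilation r Q)"
      using assms(1) unfolding heis_biLipschitz_def by blast+
    then have "inverse r * (inverse L * control_dist (heis_dilation r P) (heis_dilation r Q))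
        \<le> inverse r * control_dist (f (heis_dilation r P)) (f (heis_dilation r Q))"
      "inverse r * control_dist (f (heis_dilation r P)) (f (heis_dilation r Q))
        \<le> inverse r * (L * control_dist (heis_dilation r P) (heis_dilation r Q))"
      using \<open>0 < inverse r\<close> by (auto intro: mult_left_mono)
    then show "inverse L * control_dist P Q \<le> inverse r * control_dist (f (heis_dilation r P)) (f (heis_dilation r Q))"
      "inverse r * control_dist (f (heis_dilation r P)) (f (heis_dilation r Q)) \<le> L * control_dist P Q"
      unfolding eq[of P Q] by (simp_all only: mult.left_commute)
  qed
  then show ?thesis
    unfolding heis_biLipschitz_def control_dist_dilation[OF \<open>0 < inverse r\<close>] by blast
qed

text \<open>The first bound is the unit case after a dilation. For the second, the gauge bounds
  \<open>norm w ^ 4 + t\<^sup>2\<close> by \<open>(1 + \<epsilon>) ^ 4 * norm v ^ 4\<close>, and by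
  the first bound \<open>norm w ^ 4\<close> exhausts all of this but a multiple of
  \<open>\<eta>\<^sup>2\<close>, so the height is squeezed.\<close>

lemma biLipschitz_horizontal:
  assumes f: "heis_biLipschitz (1 + \<epsilon>) f" "f 0 = 0"
    and \<eta>: "\<epsilon> = \<eta> ^ 4" "0 < \<eta>" "\<eta> \<le> 1/1000"
  shows "(1 - 54 * \<eta>\<^sup>2) * norm v \<le> norm (fst (f (v, 0)))" (is ?proj)
    and "\<bar>snd (f (v, 0))\<bar> \<le> 15 * \<eta> * (norm v)\<^sup>2" (is ?height)
proof -
  have "\<epsilon> > 0"
    using \<eta> by simp
  have sq: "\<eta>\<^sup>2 \<le> 1/1000000"
    using power_mono[OF \<eta>(3), of 2] \<eta>(2) by (simp add: power_divide)
  have "\<epsilon> = \<eta>\<^sup>2 * \<eta>\<^sup>2"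
    by (simp add: \<eta>(1))
  then have e: "\<epsilon> \<le> \<eta>\<^sup>2 / 1000"
    using mult_left_mono[OF sq, of "\<eta>\<^sup>2"] zero_le_power2[of \<eta>] by linarith
  show proj: ?proj
  proof (cases "v = 0")
    case True
    then show ?thesis
      by simp
  next
    case False
    define r where "r = norm v"
    define u where "u = inverse r *\<^sub>R v"
    have "r > 0" "norm u = 1" "v = r *\<^sub>R u"
      using False by (auto simp: r_def u_def)
    define g where "g = (\<lambda>P. heis_dilation (inverse r) (f (heis_dilation r P)))"
    have g: "heis_biLipschitz (1 + \<epsilon>) g" "g 0 = 0"
      using heis_biLipschitz_dilation_conj[OF f(1) \<open>r > 0\<close>] f(2) by (simp_all add: g_def)
    have "1 - 54 * \<eta>\<^sup>2 \<le> norm (fst (g (u, 0)))"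
      by (rule biLipschitz_unit_projection[OF g \<eta> \<open>norm u = 1\<close>])
    also have "fst (g (u, 0)) = inverse r *\<^sub>R fst (f (v, 0))"
      by (simp add: g_def heis_dilation_def \<open>v = r *\<^sub>R u\<close>)
    finally have "1 - 54 * \<eta>\<^sup>2 \<le> norm (fst (f (v, 0))) / r"
      using \<open>r > 0\<close> by (simp add: divide_inverse mult.commute)
    then show ?thesis
      using \<open>r > 0\<close> by (simp add: pos_le_divide_eq r_def)
  qed
  have "control_dist 0 (v, 0) = norm v"
    using control_dist_horizontal[of 0 "(v, 0)"] by (simp add: heis_height_def cross2_simps)
  then have d: "control_dist 0 (f (v, 0)) \<le> (1 + \<epsilon>) * norm v"
    using heis_biLipschitz_le[OF f(1), of 0 "(v, 0)"] f(2) by simp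
  define w t where "w = fst (f (v, 0))" and "t = snd (f (v, 0))"
  have "norm w ^ 4 + t\<^sup>2 \<le> control_dist 0 (f (v, 0)) ^ 4"
    using control_dist_koranyi[of "f (v, 0)" 0] by (simp add: heis_height_def cross2_simps w_def t_def)
  also have "\<dots> \<le> ((1 + \<epsilon>) * norm v) ^ 4"
    using d by (intro power_mono) auto
  also have "\<dots> = (1 + \<epsilon>) ^ 4 * norm v ^ 4"
    by (rule power_mult_distrib)
  also have "\<dots> \<le> (1 + \<eta>\<^sup>2) * norm v ^ 4"
  proof (rule mult_right_mono)
    have "(1 + \<epsilon>)\<^sup>2 \<le> 1 + 3 * \<epsilon>"
      using \<open>\<epsilon> > 0\<close> e sq mult_left_mono[of \<epsilon> 1 \<epsilon>] by (simp add: power2_eq_square algebra_simps)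
    then have "((1 + \<epsilon>)\<^sup>2)\<^sup>2 \<le> (1 + 3 * \<epsilon>)\<^sup>2"
      by (intro power_mono) auto
    also have "\<dots> \<le> 1 + 15 * \<epsilon>"
      using \<open>\<epsilon> > 0\<close> e sq mult_left_mono[of \<epsilon> 1 \<epsilon>] by (simp add: power2_eq_square algebra_simps)
    finally show "(1 + \<epsilon>) ^ 4 \<le> 1 + \<eta>\<^sup>2"
      using e zero_le_power2[of \<eta>] unfolding power4_eq_power2_power2 by linarith
  qed simp
  finally have upper: "norm w ^ 4 + t\<^sup>2 \<le> (1 + \<eta>\<^sup>2) * norm v ^ 4" .
  \<comment> \<open>Bernoulli's inequality gives \<open>216 = 4 * 54\<close>; the upper bound adds
    one more \<open>\<eta>\<^sup>2\<close>, and 217 is rounded up to the square 225.\<close>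
  have "(1 - 216 * \<eta>\<^sup>2) * norm v ^ 4 \<le> (1 - 54 * \<eta>\<^sup>2) ^ 4 * norm v ^ 4"
  proof (rule mult_right_mono)
    have "1 + real 4 * (- (54 * \<eta>\<^sup>2)) \<le> (1 + - (54 * \<eta>\<^sup>2)) ^ 4"
      by (rule Bernoulli_inequality) (use sq in simp)
    then show "1 - 216 * \<eta>\<^sup>2 \<le> (1 - 54 * \<eta>\<^sup>2) ^ 4"
      by simp
  qed simp
  also have "\<dots> = ((1 - 54 * \<eta>\<^sup>2) * norm v) ^ 4"
    by (rule power_mult_distrib[symmetric])
  also have "\<dots> \<le> norm w ^ 4"
    using proj sq by (intro power_mono) (auto simp: w_def)
  finally have "t\<^sup>2 \<le> 217 * \<eta>\<^sup>2 * norm v ^ 4"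
    using upper by (simp add: algebra_simps)
  also have "\<dots> \<le> 225 * \<eta>\<^sup>2 * norm v ^ 4"
    by (intro mult_right_mono) auto
  also have "\<dots> = (15 * \<eta> * (norm v)\<^sup>2)\<^sup>2"
    by (simp add: power_mult_distrib)
  finally have "t\<^sup>2 \<le> (15 * \<eta> * (norm v)\<^sup>2)\<^sup>2" .
  then show ?height
    unfolding t_def by (subst (asm) power2_le_iff_abs_le) (use \<eta>(2) in auto)
qed

text \<open>Comparing the distances to a point far out on the ray through \<open>u\<close> reads off the component in
  direction \<open>u\<close>: the squared distance from \<open>(z, 0)\<close> to \<open>(M u, 0)\<close> is \<open>M\<^sup>2 - 2 M (u \<bullet> z)\<close> up to a
  bounded error.\<close>

lemma biLipschitz_linear_component:
  assumes f: "heis_biLipschitz (1 + \<epsilon>) f" "f 0 = 0"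
    and \<eta>: "\<epsilon> = \<eta> ^ 4" "0 < \<eta>" "\<eta> \<le> 1/1000" and u: "norm u = 1"
  obtains V where "\<bar>(norm V)\<^sup>2 - 1\<bar> \<le> 108 * \<eta>\<^sup>2"
    and "\<And>z. norm z \<le> 1 \<Longrightarrow> \<bar>V \<bullet> fst (f (z, 0)) - u \<bullet> z\<bar> \<le> 1155 * \<eta>"
proof -
  have "\<epsilon> > 0"
    using \<eta> by simp
  define M where "M = 1 / \<eta>"
  have M: "M \<ge> 1000" "\<eta> * M = 1"
    using \<eta>(2,3) by (simp_all add: M_def field_simps)
  have eM: "\<eta>\<^sup>2 * M\<^sup>2 = 1"
    using M(2) by (simp flip: power_mult_distrib)
  have sq: "\<eta>\<^sup>2 \<le> 1/1000000"
    using power_mono[OF \<eta>(3), of 2] \<eta>(2) by (simp add: power_divide)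
  have "\<epsilon> * M\<^sup>2 = \<eta>\<^sup>2 * (\<eta>\<^sup>2 * M\<^sup>2)"
    by (simp add: \<eta>(1) power4_eq_power2_power2 power2_eq_square)
  then have eM2: "\<epsilon> * M\<^sup>2 \<le> 1/1000000"
    using sq by (simp add: eM)
  have MM: "M * 1000 \<le> M\<^sup>2"
    using M(1) by (simp add: power2_eq_square)
  have "1 \<le> M\<^sup>2"
    using M(1) MM by linarith
  then have e1: "\<epsilon> \<le> 1/1000000"
    using eM2 mult_left_mono[of 1 "M\<^sup>2" \<epsilon>] \<open>\<epsilon> > 0\<close> by linarith
  define W T where "W = fst (f (M *\<^sub>R u, 0))" and "T = snd (f (M *\<^sub>R u, 0))"
  have nMu: "norm (M *\<^sub>R u) = M"
    using u M by simp
  have T: "\<bar>T\<bar> \<le> 15 * M"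
  proof -
    have "\<bar>T\<bar> \<le> 15 * \<eta> * M\<^sup>2"
      using biLipschitz_horizontal(2)[OF f \<eta>, of "M *\<^sub>R u"] unfolding nMu T_def .
    also have "\<dots> = 15 * M * (\<eta> * M)"
      by (simp add: power2_eq_square)
    finally show ?thesis
      by (simp add: M)
  qed
  have W_ge: "(1 - 54 * \<eta>\<^sup>2) * M \<le> norm W"
    using biLipschitz_horizontal(1)[OF f \<eta>, of "M *\<^sub>R u"] unfolding nMu W_def .
  have W_le: "norm W \<le> (1 + \<epsilon>) * M"
  proof -
    have "control_dist 0 (M *\<^sub>R u, 0) = M"
      using control_dist_horizontal[of 0 "(M *\<^sub>R u, 0)"] nMu by (simp add: heis_height_def cross2_simps)
    then show ?thesis
      using heis_biLipschitz_le[OF f(1), of 0 "(M *\<^sub>R u, 0)"] f(2)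
        norm_fst_diff_le_control_dist[of "f (M *\<^sub>R u, 0)" 0] by (simp add: W_def)
  qed
  have W2_ge: "M\<^sup>2 - 108 \<le> (norm W)\<^sup>2"
  proof -
    have "((1 - 54 * \<eta>\<^sup>2) * M)\<^sup>2 \<le> (norm W)\<^sup>2"
      using W_ge sq M by (intro power_mono) auto
    moreover have "((1 - 54 * \<eta>\<^sup>2) * M)\<^sup>2 = M\<^sup>2 - 108 * (\<eta>\<^sup>2 * M\<^sup>2) + (54 * \<eta>\<^sup>2 * M)\<^sup>2"
      by (simp add: power2_eq_square algebra_simps)
    moreover have "0 \<le> (54 * \<eta>\<^sup>2 * M)\<^sup>2"
      by simp
    ultimately show ?thesis
      unfolding eM by linarith
  qed
  have W2_le: "(norm W)\<^sup>2 \<le> M\<^sup>2 + 1"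
  proof -
    have "(norm W)\<^sup>2 \<le> ((1 + \<epsilon>) * M)\<^sup>2"
      using W_le by (intro power_mono) auto
    also have "\<dots> = M\<^sup>2 + (2 + \<epsilon>) * (\<epsilon> * M\<^sup>2)"
      by (simp add: power2_eq_square algebra_simps)
    also have "(2 + \<epsilon>) * (\<epsilon> * M\<^sup>2) \<le> 3 * (1/1000000)"
      using eM2 e1 \<open>\<epsilon> > 0\<close> by (intro mult_mono) auto
    finally show ?thesis
      by simp
  qed
  have comp: "\<bar>W \<bullet> fst (f (z, 0)) - M * (u \<bullet> z)\<bar> \<le> 1155" if z: "norm z \<le> 1" for z
  proof -
    define z' t' where "z' = fst (f (z, 0))" and "t' = snd (f (z, 0))"
    have d0: "control_dist 0 (f (z, 0)) \<le> 1 + \<epsilon>"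
    proof -
      have "control_dist 0 (z, 0) \<le> 1"
        using control_dist_horizontal[of 0 "(z, 0)"] z by (simp add: heis_height_def cross2_simps)
      then have "(1 + \<epsilon>) * control_dist 0 (z, 0) \<le> 1 + \<epsilon>"
        using mult_left_mono[of _ 1 "1 + \<epsilon>"] \<open>\<epsilon> > 0\<close> by simp
      then show ?thesis
        using heis_biLipschitz_le[OF f(1), of 0 "(z, 0)"] f(2) by simp
    qed
    have z': "norm z' \<le> 2"
      using norm_fst_diff_le_control_dist[of "f (z, 0)" 0] d0 e1 by (simp add: z'_def)
    have t': "\<bar>t'\<bar> \<le> 4"
    proof -
      have "(control_dist 0 (f (z, 0)))\<^sup>2 \<le> 2\<^sup>2"
        using d0 e1 by (intro power_mono) auto
      then show ?thesis
        using abs_heis_height_le[of 0 "f (z, 0)"] by (simp add: heis_height_def cross2_simps t'_def)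
    qed
    have uz: "\<bar>u \<bullet> z\<bar> \<le> 1"
      using Cauchy_Schwarz_ineq2[of u z] u z by simp
    let ?d = "control_dist (z, 0) (M *\<^sub>R u, 0)" and ?d' = "control_dist (f (z, 0)) (f (M *\<^sub>R u, 0))"
    have dist2: "(norm (M *\<^sub>R u - z))\<^sup>2 = M\<^sup>2 - 2 * M * (u \<bullet> z) + (norm z)\<^sup>2"
    proof -
      have "(norm (M *\<^sub>R u - z))\<^sup>2 = M\<^sup>2 * (norm u)\<^sup>2 - 2 * M * (u \<bullet> z) + (norm z)\<^sup>2"
        unfolding power2_norm_eq_inner by (simp add: inner_diff inner_commute power2_eq_square)
      then show ?thesis
        by (simp add: u)
    qed
    have nz2: "0 \<le> (norm z)\<^sup>2" "(norm z)\<^sup>2 \<le> 1"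
      using z by (simp_all add: power_le_one)
    have dist2': "(norm (W - z'))\<^sup>2 = (norm W)\<^sup>2 - 2 * (W \<bullet> z') + (norm z')\<^sup>2"
      by (simp add: power2_norm_eq_inner inner_diff inner_commute)
    have nz'2: "0 \<le> (norm z')\<^sup>2" "(norm z')\<^sup>2 \<le> 4"
      using power_mono[OF z', of 2] by simp_all
    have "\<bar>M * (u \<bullet> z)\<bar> \<le> M"
      using uz M mult_left_mono[OF uz, of M] by (simp add: abs_mult)
    then have Muz: "M * (u \<bullet> z) \<le> M" "- M \<le> M * (u \<bullet> z)"
      by linarith+
    have d_ge: "M\<^sup>2 - 2 * M * (u \<bullet> z) \<le> ?d\<^sup>2"
    proof -
      have "(norm (M *\<^sub>R u - z))\<^sup>2 \<le> ?d\<^sup>2"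
        using norm_fst_diff_le_control_dist[of "(M *\<^sub>R u, 0)" "(z, 0)"] by (intro power_mono) auto
      then show ?thesis
        using dist2 nz2 by linarith
    qed
    have d_le: "?d\<^sup>2 \<le> M\<^sup>2 - 2 * M * (u \<bullet> z) + 17"
    proof -
      have far: "M / 2 \<le> norm (M *\<^sub>R u - z)"
        using norm_triangle_ineq2[of "M *\<^sub>R u" z] nMu z M by linarith
      have "\<bar>heis_height (z, 0) (M *\<^sub>R u, 0)\<bar> \<le> 2 * M"
      proof -
        have "\<bar>cross2 z (M *\<^sub>R u)\<bar> \<le> 1 * M"
          using abs_cross2_le[of z "M *\<^sub>R u"] z M mult_right_mono[OF z, of M] unfolding nMu by linarith
        then show ?thesis
          by (simp add: heis_height_def)
      qed
      then have "(heis_height (z, 0) (M *\<^sub>R u, 0))\<^sup>2 \<le> (2 * M)\<^sup>2"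
        using M by (subst power2_le_iff_abs_le) auto
      then have "(heis_height (z, 0) (M *\<^sub>R u, 0))\<^sup>2 / (norm (M *\<^sub>R u - z))\<^sup>2 \<le> (2 * M)\<^sup>2 / (M / 2)\<^sup>2"
        by (rule frac_le[OF zero_le_power2 _ _ power_mono[OF far]]) (use M in auto)
      also have "(2 * M)\<^sup>2 / (M / 2)\<^sup>2 = 16"
        using M by (simp add: power_mult_distrib power_divide)
      finally have "(heis_height (z, 0) (M *\<^sub>R u, 0))\<^sup>2 / (norm (M *\<^sub>R u - z))\<^sup>2 \<le> 16" .
      moreover have "M *\<^sub>R u \<noteq> z"
        using far M by auto
      ultimately show ?thesis
        using control_dist_two_segments[of "(M *\<^sub>R u, 0)" "(z, 0)"] dist2 nz2 by simp
    qed
    \<comment> \<open>The image distance is bounded below by its planar part and the original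
      distance above by two segments; in \<open>upper\<close> the roles are exchanged.\<close>
    have lower: "M * (u \<bullet> z) - 1155 \<le> W \<bullet> z'"
    proof -
      have "norm (W - z') \<le> ?d'"
        using norm_fst_diff_le_control_dist[of "f (M *\<^sub>R u, 0)" "f (z, 0)"] by (simp add: W_def z'_def)
      also have "\<dots> \<le> (1 + \<epsilon>) * ?d"
        by (rule heis_biLipschitz_le[OF f(1)])
      finally have "(norm (W - z'))\<^sup>2 \<le> ((1 + \<epsilon>) * ?d)\<^sup>2"
        by (intro power_mono) auto
      also have "\<dots> = ?d\<^sup>2 + (2 + \<epsilon>) * (\<epsilon> * ?d\<^sup>2)"
        by (simp add: power2_eq_square algebra_simps)
      also have "(2 + \<epsilon>) * (\<epsilon> * ?d\<^sup>2) \<le> 3 * (\<epsilon> * (2 * M\<^sup>2))"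
        using d_le Muz MM M e1 \<open>\<epsilon> > 0\<close> by (intro mult_mono) auto
      also have "3 * (\<epsilon> * (2 * M\<^sup>2)) \<le> 1"
        using eM2 by simp
      finally show ?thesis
        using d_le dist2' nz'2 W2_ge by linarith
    qed
    \<comment> \<open>A height of at most \<open>24 * M\<close> over a planar distance of at least
      \<open>M / 2\<close> adds \<open>48\<^sup>2 = 2304\<close> to the squared distance. Half of
      this, together with half of the smaller errors, is below 1155.\<close>
    have upper: "W \<bullet> z' \<le> M * (u \<bullet> z) + 1155"
    proof -
      have far: "M / 2 \<le> norm (W - z')"
      proof -
        have "(1 - 54 * \<eta>\<^sup>2) * M \<ge> (9/10) * M"
          using sq M by (intro mult_right_mono) auto
        then show ?thesis
          using norm_triangle_ineq2[of W z'] z' M W_ge by linarith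
      qed
      have "\<bar>heis_height (f (z, 0)) (f (M *\<^sub>R u, 0))\<bar> \<le> 24 * M"
      proof -
        have "norm W \<le> 11/10 * M"
        proof -
          have "(1 + \<epsilon>) * M \<le> 11/10 * M"
            using e1 M by (intro mult_right_mono) auto
          then show ?thesis
            using W_le by linarith
        qed
        then have "norm z' * norm W \<le> 2 * (11/10 * M)"
          using z' M by (intro mult_mono) auto
        then have "\<bar>cross2 z' W\<bar> \<le> 22/10 * M"
          using abs_cross2_le[of z' W] by linarith
        moreover have "heis_height (f (z, 0)) (f (M *\<^sub>R u, 0)) = T - t' + 2 * cross2 z' W"
          by (simp add: heis_height_def T_def t'_def z'_def W_def)
        ultimately show ?thesis
          using T t' M by linarith
      qed
      then have "(heis_height (f (z, 0)) (f (M *\<^sub>R u, 0)))\<^sup>2 \<le> (24 * M)\<^sup>2"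
        using M by (subst power2_le_iff_abs_le) auto
      then have "(heis_height (f (z, 0)) (f (M *\<^sub>R u, 0)))\<^sup>2 / (norm (W - z'))\<^sup>2 \<le> (24 * M)\<^sup>2 / (M / 2)\<^sup>2"
        by (rule frac_le[OF zero_le_power2 _ _ power_mono[OF far]]) (use M in auto)
      also have "(24 * M)\<^sup>2 / (M / 2)\<^sup>2 = 2304"
        using M by (simp add: power_mult_distrib power_divide)
      finally have h: "(heis_height (f (z, 0)) (f (M *\<^sub>R u, 0)))\<^sup>2 / (norm (W - z'))\<^sup>2 \<le> 2304" .
      have "W \<noteq> z'"
        using far M by auto
      with h control_dist_two_segments[of "f (M *\<^sub>R u, 0)" "f (z, 0)"]
      have "?d'\<^sup>2 \<le> (norm (W - z'))\<^sup>2 + 2304"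
        by (simp add: W_def z'_def)
      moreover have "((1 - \<epsilon>) * ?d)\<^sup>2 \<le> ?d'\<^sup>2"
        using heis_biLipschitz_ge[OF f(1) \<open>\<epsilon> > 0\<close>] e1 by (intro power_mono) auto
      moreover have "((1 - \<epsilon>) * ?d)\<^sup>2 = ?d\<^sup>2 - 2 * (\<epsilon> * ?d\<^sup>2) + (\<epsilon> * ?d)\<^sup>2"
        by (simp add: power2_eq_square algebra_simps)
      moreover have "\<epsilon> * ?d\<^sup>2 \<le> \<epsilon> * (2 * M\<^sup>2)"
        using d_le Muz MM M \<open>\<epsilon> > 0\<close> by (intro mult_left_mono) auto
      moreover have "0 \<le> (\<epsilon> * ?d)\<^sup>2"
        by simp
      ultimately show ?thesis
        using d_ge dist2' nz'2 W2_le eM2 by linarith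
    qed
    show ?thesis
      using lower upper unfolding z'_def by (simp add: abs_le_iff)
  qed
  \<comment> \<open>Rescaling by \<open>\<eta> = 1 / M\<close> turns the bounded error into one of
    order \<open>\<eta>\<close>.\<close>
  define V where "V = \<eta> *\<^sub>R W"
  have "(norm V)\<^sup>2 - 1 = \<eta>\<^sup>2 * ((norm W)\<^sup>2 - M\<^sup>2)"
    using \<eta>(2) eM by (simp add: V_def power_mult_distrib algebra_simps)
  then have "\<bar>(norm V)\<^sup>2 - 1\<bar> = \<eta>\<^sup>2 * \<bar>(norm W)\<^sup>2 - M\<^sup>2\<bar>"
    by (simp add: abs_mult)
  also have "\<dots> \<le> \<eta>\<^sup>2 * 108"
    using W2_ge W2_le by (intro mult_left_mono) auto
  finally have V: "\<bar>(norm V)\<^sup>2 - 1\<bar> \<le> 108 * \<eta>\<^sup>2"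
    by (simp add: mult.commute)
  show thesis
  proof (rule that[OF V])
    fix z :: "real ^ 2" assume "norm z \<le> 1"
    have "V \<bullet> fst (f (z, 0)) - u \<bullet> z = V \<bullet> fst (f (z, 0)) - (\<eta> * M) * (u \<bullet> z)"
      by (simp add: M)
    also have "\<dots> = \<eta> * (W \<bullet> fst (f (z, 0)) - M * (u \<bullet> z))"
      by (simp add: V_def algebra_simps)
    finally have "\<bar>V \<bullet> fst (f (z, 0)) - u \<bullet> z\<bar> = \<eta> * \<bar>W \<bullet> fst (f (z, 0)) - M * (u \<bullet> z)\<bar>"
      using \<eta>(2) by (simp add: abs_mult)
    also have "\<dots> \<le> \<eta> * 1155"
      using comp[OF \<open>norm z \<le> 1\<close>] \<eta>(2) by (intro mult_left_mono) auto
    finally show "\<bar>V \<bullet> fst (f (z, 0)) - u \<bullet> z\<bar> \<le> 1155 * \<eta>"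
      by (simp add: mult.commute)
  qed
qed

section \<open>The approximating orthogonal matrix\<close>

definition rot90 :: "real ^ 2 \<Rightarrow> real ^ 2" where
  "rot90 z = vector [- z $ 2, z $ 1]"

lemma inner_real_2: "(z :: real ^ 2) \<bullet> w = z $ 1 * w $ 1 + z $ 2 * w $ 2"
  by (simp add: inner_vec_def sum_2)

lemma rot90_expansion:
  assumes "norm p = 1"
  shows "z = (z \<bullet> p) *\<^sub>R p + (z \<bullet> rot90 p) *\<^sub>R rot90 p"
proof -
  have p: "p $ 1 * p $ 1 + p $ 2 * p $ 2 = 1"
    using assms by (simp add: norm_eq_1 inner_real_2)
  have "(z \<bullet> p) * p $ 1 - (z \<bullet> rot90 p) * p $ 2 = z $ 1 * (p $ 1 * p $ 1 + p $ 2 * p $ 2)"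
    "(z \<bullet> p) * p $ 2 + (z \<bullet> rot90 p) * p $ 1 = z $ 2 * (p $ 1 * p $ 1 + p $ 2 * p $ 2)"
    by (simp_all add: rot90_def inner_real_2 algebra_simps)
  then show ?thesis
    by (simp add: p rot90_def vec_eq_iff forall_2)
qed

lemma norm_rot90: "norm (rot90 p) = norm p"
  by (simp add: rot90_def norm_real_2 add.commute)

text \<open>For a unit vector \<open>p\<close>, the value \<open>\<sigma> = 1\<close> gives a
  rotation and \<open>\<sigma> = - 1\<close> a reflection; both occur, since \<open>f\<close> may
  reverse the orientation of the plane.\<close>

definition frame_matrix :: "real ^ 2 \<Rightarrow> real \<Rightarrow> real ^ 2 ^ 2" where
  "frame_matrix p \<sigma> = (\<chi> i j. if j = 1 then p $ i else \<sigma> * rot90 p $ i)"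

lemma frame_matrix_mult: "frame_matrix p \<sigma> *v z = z $ 1 *\<^sub>R p + (\<sigma> * z $ 2) *\<^sub>R rot90 p"
  by (simp add: frame_matrix_def matrix_vector_mult_def sum_2 vec_eq_iff algebra_simps)

lemma orthogonal_frame_matrix:
  assumes "norm p = 1" "\<bar>\<sigma>\<bar> = 1"
  shows "orthogonal_matrix (frame_matrix p \<sigma>)"
proof -
  have p: "p $ 1 * p $ 1 + p $ 2 * p $ 2 = 1"
    using assms by (simp add: norm_eq_1 inner_real_2)
  have "\<sigma> = 1 \<or> \<sigma> = - 1"
    using assms(2) by linarith
  with p show ?thesis
    unfolding orthogonal_matrix
    by (auto simp: frame_matrix_def transpose_def matrix_matrix_mult_def mat_def rot90_def sum_2 vec_eq_iff forall_2
      algebra_simps)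
qed

text \<open>Inner products with \<open>V1\<close> and \<open>V2\<close> read off the coordinates of
  \<open>z\<close> from its planar image up to a multiple of \<open>\<eta>\<close>. Replacing these
  vectors by the orthonormal frame of \<open>p\<close> and \<open>\<sigma>\<close> times
  \<open>rot90 p\<close> changes the readings by a multiple of \<open>\<mu>\<close>, and coordinates
  in an orthonormal frame determine the vector.\<close>

lemma biLipschitz_unit_disc:
  assumes f: "heis_biLipschitz (1 + \<epsilon>) f" "f 0 = 0"
    and \<mu>: "\<epsilon> = \<mu> ^ 8" "0 < \<mu>" "\<mu> \<le> 1/1000"
  obtains A :: "real ^ 2 ^ 2" where "orthogonal_matrix A"
    and "\<And>z. norm z \<le> 1 \<Longrightarrow> control_dist (f (z, 0)) (A *v z, 0) \<le> 90 * sqrt \<mu>"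
proof -
  define \<eta> where "\<eta> = \<mu>\<^sup>2"
  have "\<eta> = \<mu> * \<mu>"
    by (simp add: \<eta>_def power2_eq_square)
  then have \<eta>\<mu>: "\<eta> \<le> \<mu> / 1000"
    using mult_left_mono[OF \<mu>(3), of \<mu>] \<mu>(2) by simp
  have \<eta>: "\<epsilon> = \<eta> ^ 4" "0 < \<eta>" "\<eta> \<le> 1/1000"
    using \<mu> \<eta>\<mu> by (simp_all add: \<eta>_def)
  have \<eta>2: "\<eta>\<^sup>2 \<le> \<eta> / 1000" "0 \<le> \<eta>\<^sup>2"
    using mult_left_mono[OF \<eta>(3), of \<eta>] \<eta>(2) by (simp_all add: power2_eq_square)
  have "\<eta> ^ 4 \<le> \<eta>\<^sup>2"
    using \<eta>(2,3) by (intro power_decreasing) auto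
  then have e: "\<epsilon> \<le> \<eta> / 1000" "\<epsilon> > 0"
    using \<eta>2 \<eta>(1,2) by auto
  let ?e1 = "axis 1 1 :: real ^ 2" and ?e2 = "axis 2 1 :: real ^ 2"
  obtain V1 where V1: "\<bar>(norm V1)\<^sup>2 - 1\<bar> \<le> 108 * \<eta>\<^sup>2"
    "\<And>z. norm z \<le> 1 \<Longrightarrow> \<bar>V1 \<bullet> fst (f (z, 0)) - ?e1 \<bullet> z\<bar> \<le> 1155 * \<eta>"
    using biLipschitz_linear_component[OF f \<eta>, of ?e1] by auto
  obtain V2 where V2: "\<bar>(norm V2)\<^sup>2 - 1\<bar> \<le> 108 * \<eta>\<^sup>2"
    "\<And>z. norm z \<le> 1 \<Longrightarrow> \<bar>V2 \<bullet> fst (f (z, 0)) - ?e2 \<bullet> z\<bar> \<le> 1155 * \<eta>"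
    using biLipschitz_linear_component[OF f \<eta>, of ?e2] by auto
  have fst_le: "norm (fst (f (z, 0))) \<le> 1 + \<epsilon>" if "norm z \<le> 1" for z
  proof -
    have "control_dist 0 (z, 0) \<le> 1"
      using control_dist_horizontal[of 0 "(z, 0)"] that by (simp add: heis_height_def cross2_simps)
    then have "(1 + \<epsilon>) * control_dist 0 (z, 0) \<le> (1 + \<epsilon>) * 1"
      using e by (intro mult_left_mono) auto
    then show ?thesis
      using heis_biLipschitz_le[OF f(1), of 0 "(z, 0)"] f(2) norm_fst_diff_le_control_dist[of "f (z, 0)" 0] by simp
  qed
  have n: "\<bar>norm V - 1\<bar> \<le> \<mu>" "\<bar>norm V - 1\<bar> \<le> \<eta>" if "\<bar>(norm V)\<^sup>2 - 1\<bar> \<le> 108 * \<eta>\<^sup>2" for V :: "real ^ 2"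
  proof -
    have "(norm V)\<^sup>2 - 1 = (norm V - 1) * (norm V + 1)"
      by (simp add: power2_eq_square algebra_simps)
    then have "\<bar>(norm V)\<^sup>2 - 1\<bar> = \<bar>norm V - 1\<bar> * (norm V + 1)"
      by (simp add: abs_mult)
    moreover have "\<bar>norm V - 1\<bar> * 1 \<le> \<bar>norm V - 1\<bar> * (norm V + 1)"
      by (intro mult_left_mono) auto
    ultimately have "\<bar>norm V - 1\<bar> \<le> \<bar>(norm V)\<^sup>2 - 1\<bar>"
      by simp
    then have "\<bar>norm V - 1\<bar> \<le> 108 * \<eta>\<^sup>2"
      using that by (rule order_trans)
    then show "\<bar>norm V - 1\<bar> \<le> \<mu>" "\<bar>norm V - 1\<bar> \<le> \<eta>"
      using \<eta>2 \<eta>\<mu> \<eta>(2) \<mu>(2) by linarith+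
  qed
  \<comment> \<open>The planar image \<open>g\<close> of the first basis vector has length at most
    about 1, and \<open>V1 \<bullet> g\<close> is almost 1, so the squared distance from
    \<open>V1\<close> to \<open>g\<close> is of order \<open>\<eta> = \<mu>\<^sup>2\<close>. Hence
    \<open>V1\<close> may be replaced by \<open>g\<close>, to which \<open>V2\<close> is almost
    orthogonal.\<close>
  have V12: "\<bar>V1 \<bullet> V2\<bar> \<le> 60 * \<mu>"
  proof -
    define g where "g = fst (f (?e1, 0))"
    have g: "norm g \<le> 1 + \<epsilon>" "\<bar>V1 \<bullet> g - 1\<bar> \<le> 1155 * \<eta>" "\<bar>V2 \<bullet> g\<bar> \<le> 1155 * \<eta>"
      using fst_le[of ?e1] V1(2)[of ?e1] V2(2)[of ?e1] by (simp_all add: g_def inner_axis_axis)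
    have "(norm g)\<^sup>2 \<le> (1 + \<epsilon>)\<^sup>2"
      using g(1) by (intro power_mono) auto
    also have "\<dots> = 1 + \<epsilon> * (2 + \<epsilon>)"
      by (simp add: power2_eq_square algebra_simps)
    also have "\<epsilon> * (2 + \<epsilon>) \<le> \<epsilon> * 3"
      using e \<eta>(3) by (intro mult_left_mono) auto
    finally have g2: "(norm g)\<^sup>2 \<le> 1 + 3 * \<epsilon>"
      by simp
    have "(norm (V1 - g))\<^sup>2 = (norm V1)\<^sup>2 - 2 * (V1 \<bullet> g) + (norm g)\<^sup>2"
      by (simp add: power2_norm_eq_inner inner_diff inner_commute)
    also have "\<dots> \<le> 2500 * \<eta>"
      using g2 g(2) V1(1) e(1) \<eta>2(1) by linarith
    also have "\<dots> = (50 * \<mu>)\<^sup>2"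
      by (simp add: \<eta>_def power_mult_distrib)
    finally have "norm (V1 - g) \<le> 50 * \<mu>"
      by (rule power2_le_imp_le) (use \<mu> in simp)
    then have "norm (V1 - g) * norm V2 \<le> 50 * \<mu> * (11/10)"
      using n(1)[OF V2(1)] \<mu> by (intro mult_mono) auto
    then have "\<bar>(V1 - g) \<bullet> V2\<bar> \<le> 55 * \<mu>"
      using Cauchy_Schwarz_ineq2[of "V1 - g" V2] by simp
    moreover have "V1 \<bullet> V2 = (V1 - g) \<bullet> V2 + V2 \<bullet> g"
      by (simp add: inner_diff inner_commute)
    ultimately show ?thesis
      using g(3) \<eta>\<mu> by linarith
  qed
  define n1 where "n1 = norm V1"
  have n1: "\<bar>n1 - 1\<bar> \<le> \<eta>" "9/10 \<le> n1"
    using n(2)[OF V1(1)] \<eta>(3) by (auto simp: n1_def)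
  define p where "p = inverse n1 *\<^sub>R V1"
  have p: "norm p = 1" "V1 = n1 *\<^sub>R p"
  proof -
    have "n1 \<noteq> 0"
      using n1(2) by auto
    then show "norm p = 1" "V1 = n1 *\<^sub>R p"
      by (simp_all add: p_def n1_def)
  qed
  \<comment> \<open>Near-orthogonality makes \<open>b\<close> small; the length of \<open>V2\<close>
    then forces \<open>s\<close> close to 1 or to -1, and \<open>\<sigma>\<close> records
    which.\<close>
  define b s where "b = V2 \<bullet> p" and "s = V2 \<bullet> rot90 p"
  have V2_eq: "V2 = b *\<^sub>R p + s *\<^sub>R rot90 p"
    unfolding b_def s_def by (rule rot90_expansion[OF p(1)])
  have b: "\<bar>b\<bar> \<le> 70 * \<mu>"
  proof -
    have "V1 \<bullet> V2 = n1 * b"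
      by (simp add: p(2) b_def inner_commute)
    then have "n1 * \<bar>b\<bar> \<le> 60 * \<mu>"
      using V12 n1(2) by (simp add: abs_mult)
    moreover have "9/10 * \<bar>b\<bar> \<le> n1 * \<bar>b\<bar>"
      using n1(2) by (intro mult_right_mono) auto
    ultimately show ?thesis
      using \<mu>(2) by linarith
  qed
  have "p \<bullet> rot90 p = 0"
    by (simp add: inner_real_2 rot90_def)
  then have "(norm V2)\<^sup>2 = b\<^sup>2 * (norm p)\<^sup>2 + s\<^sup>2 * (norm (rot90 p))\<^sup>2"
    unfolding V2_eq power2_norm_eq_inner
    by (simp add: inner_add inner_commute[of "rot90 p" p] power2_eq_square)
  then have s2: "s\<^sup>2 = (norm V2)\<^sup>2 - b\<^sup>2"
    by (simp add: norm_rot90 p(1))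
  have "b\<^sup>2 \<le> (70 * \<mu>)\<^sup>2"
    using b \<mu>(2) by (subst power2_le_iff_abs_le) auto
  then have "b\<^sup>2 \<le> 4900 * \<eta>"
    by (simp add: \<eta>_def power_mult_distrib)
  then have s2': "\<bar>s\<^sup>2 - 1\<bar> \<le> 5 * \<mu>"
    using s2 V2(1) \<eta>2 \<eta>\<mu> zero_le_power2[of b] \<mu>(2) by linarith
  define \<sigma> where "\<sigma> = sgn s"
  have "s \<noteq> 0"
    using s2' \<mu>(3) by auto
  then have \<sigma>: "\<bar>\<sigma>\<bar> = 1"
    by (simp add: \<sigma>_def abs_sgn_eq)
  have s\<sigma>: "\<bar>s - \<sigma>\<bar> \<le> 5 * \<mu>"
  proof -
    have "\<bar>s - \<sigma>\<bar> = \<bar>\<bar>s\<bar> - 1\<bar>"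
      using \<open>s \<noteq> 0\<close> by (auto simp: \<sigma>_def sgn_if)
    also have "\<dots> \<le> \<bar>\<bar>s\<bar> - 1\<bar> * (\<bar>s\<bar> + 1)"
      using mult_left_mono[of 1 "\<bar>s\<bar> + 1" "\<bar>\<bar>s\<bar> - 1\<bar>"] by simp
    also have "\<dots> = \<bar>(\<bar>s\<bar> - 1) * (\<bar>s\<bar> + 1)\<bar>"
      by (simp add: abs_mult)
    also have "(\<bar>s\<bar> - 1) * (\<bar>s\<bar> + 1) = s\<^sup>2 - 1"
      by (simp add: power2_eq_square algebra_simps)
    finally show ?thesis
      using s2' by linarith
  qed
  define A where "A = frame_matrix p \<sigma>"
  have "control_dist (f (z, 0)) (A *v z, 0) \<le> 90 * sqrt \<mu>" if z: "norm z \<le> 1" for z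
  proof -
    define z' where "z' = fst (f (z, 0))"
    have z': "norm z' \<le> 2"
      using fst_le[OF z] e \<eta>(3) by (simp add: z'_def)
    have zi: "?e1 \<bullet> z = z $ 1" "?e2 \<bullet> z = z $ 2"
      by (simp_all add: inner_real_2 axis_def)
    have zp: "\<bar>z' \<bullet> p\<bar> \<le> 2" "\<bar>z' \<bullet> rot90 p\<bar> \<le> 2"
      using Cauchy_Schwarz_ineq2[of z' p] Cauchy_Schwarz_ineq2[of z' "rot90 p"] z' p(1) by (simp_all add: norm_rot90)
    have c1: "\<bar>z' \<bullet> p - z $ 1\<bar> \<le> 2 * \<mu>"
    proof -
      have "\<bar>n1 * (z' \<bullet> p) - z $ 1\<bar> \<le> 1155 * \<eta>"
        using V1(2)[OF z] unfolding zi by (simp add: p(2) z'_def inner_commute)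
      moreover have "\<bar>(n1 - 1) * (z' \<bullet> p)\<bar> \<le> \<eta> * 2"
        unfolding abs_mult using n1(1) zp(1) by (intro mult_mono) auto
      moreover have "(n1 - 1) * (z' \<bullet> p) = n1 * (z' \<bullet> p) - z' \<bullet> p"
        by (simp add: algebra_simps)
      ultimately show ?thesis
        using \<eta>\<mu> \<mu>(2) by linarith
    qed
    \<comment> \<open>Replacing \<open>V2\<close> by \<open>\<sigma>\<close> times
      \<open>rot90 p\<close> costs \<open>140 * \<mu>\<close> through \<open>b\<close> and
      \<open>10 * \<mu>\<close> through \<open>s - \<sigma>\<close>; the reading error
      \<open>1155 * \<eta>\<close> is below \<open>2 * \<mu>\<close>.\<close>
    have c2: "\<bar>z' \<bullet> rot90 p - \<sigma> * z $ 2\<bar> \<le> 160 * \<mu>"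
    proof -
      have "V2 \<bullet> z' = b * (z' \<bullet> p) + s * (z' \<bullet> rot90 p)"
        by (subst V2_eq) (simp add: inner_add inner_commute)
      then have "\<bar>b * (z' \<bullet> p) + s * (z' \<bullet> rot90 p) - z $ 2\<bar> \<le> 1155 * \<eta>"
        using V2(2)[OF z] unfolding zi by (simp add: z'_def)
      moreover have "\<bar>b * (z' \<bullet> p)\<bar> \<le> 70 * \<mu> * 2"
        unfolding abs_mult using b zp(1) \<mu>(2) by (intro mult_mono) auto
      moreover have "\<bar>(s - \<sigma>) * (z' \<bullet> rot90 p)\<bar> \<le> 5 * \<mu> * 2"
        unfolding abs_mult using s\<sigma> zp(2) \<mu>(2) by (intro mult_mono) auto
      moreover have "(s - \<sigma>) * (z' \<bullet> rot90 p) = s * (z' \<bullet> rot90 p) - \<sigma> * (z' \<bullet> rot90 p)"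
        by (simp add: algebra_simps)
      ultimately have "\<bar>\<sigma> * (z' \<bullet> rot90 p) - z $ 2\<bar> \<le> 160 * \<mu>"
        using \<eta>\<mu> \<mu>(2) by linarith
      moreover have "\<sigma> * \<sigma> = 1"
        using \<sigma> by (simp add: \<sigma>_def sgn_if split: if_splits)
      then have "\<sigma> * (z' \<bullet> rot90 p) - z $ 2 = \<sigma> * (z' \<bullet> rot90 p - \<sigma> * z $ 2)"
        by (simp add: right_diff_distrib flip: mult.assoc)
      ultimately show ?thesis
        by (simp add: abs_mult \<sigma>)
    qed
    have "A *v z - z' = - ((z' \<bullet> p - z $ 1) *\<^sub>R p + (z' \<bullet> rot90 p - \<sigma> * z $ 2) *\<^sub>R rot90 p)"
      by (subst (1) rot90_expansion[OF p(1), of z']) (simp add: A_def frame_matrix_mult algebra_simps)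
    then have "norm (A *v z - z') \<le> \<bar>z' \<bullet> p - z $ 1\<bar> * norm p + \<bar>z' \<bullet> rot90 p - \<sigma> * z $ 2\<bar> * norm (rot90 p)"
      using norm_triangle_ineq[of "(z' \<bullet> p - z $ 1) *\<^sub>R p" "(z' \<bullet> rot90 p - \<sigma> * z $ 2) *\<^sub>R rot90 p"]
      by (simp only: norm_minus_cancel norm_scaleR)
    then have close: "norm (A *v z - z') \<le> 162 * \<mu>"
      using c1 c2 by (simp add: norm_rot90 p(1))
    have "heis_height (f (z, 0)) (A *v z, 0) = - snd (f (z, 0)) + 2 * cross2 z' (A *v z - z')"
      by (simp add: heis_height_def z'_def cross2_simps)
    moreover have "\<bar>snd (f (z, 0))\<bar> \<le> 15 * \<mu>"
    proof -
      have "15 * \<eta> * (norm z)\<^sup>2 \<le> 15 * \<eta> * 1"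
        using z \<eta>(2) by (intro mult_left_mono) (auto simp: power_le_one)
      then show ?thesis
        using biLipschitz_horizontal(2)[OF f \<eta>, of z] \<eta>\<mu> \<mu>(2) by linarith
    qed
    moreover have "\<bar>cross2 z' (A *v z - z')\<bar> \<le> 2 * (162 * \<mu>)"
    proof -
      have "norm z' * norm (A *v z - z') \<le> 2 * (162 * \<mu>)"
        using z' close by (intro mult_mono) auto
      then show ?thesis
        using abs_cross2_le[of z' "A *v z - z'"] by linarith
    qed
    ultimately have "\<bar>heis_height (f (z, 0)) (A *v z, 0)\<bar> \<le> 768 * \<mu>"
      using \<mu>(2) by linarith
    then have h: "\<bar>heis_height (f (z, 0)) (A *v z, 0)\<bar> \<le> (28 * sqrt \<mu>)\<^sup>2"
      using \<mu>(2) by (simp add: power_mult_distrib)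
    \<comment> \<open>The factor 3 of the ball-box bound turns 28 into 84, and the planar error
      \<open>162 * \<mu>\<close> is below \<open>6 * sqrt \<mu>\<close>; together they give
      90.\<close>
    have "sqrt \<bar>heis_height (f (z, 0)) (A *v z, 0)\<bar> \<le> 28 * sqrt \<mu>"
      by (rule real_le_lsqrt[OF _ h]) (use \<mu>(2) in auto)
    moreover have "\<mu> \<le> sqrt \<mu> * (1/30)"
    proof -
      have "sqrt \<mu> \<le> sqrt ((1/30)\<^sup>2)"
        using \<mu>(3) by (intro real_sqrt_le_mono) (simp add: power_divide)
      then have "sqrt \<mu> * sqrt \<mu> \<le> sqrt \<mu> * (1/30)"
        using \<mu>(2) by (intro mult_left_mono) auto
      then show ?thesis
        using \<mu>(2) by simp
    qed
    ultimately have "norm (A *v z - z') + 3 * sqrt \<bar>heis_height (f (z, 0)) (A *v z, 0)\<bar> \<le> 90 * sqrt \<mu>"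
      using close \<mu>(2) by linarith
    then show ?thesis
      using control_dist_ball_box[of "f (z, 0)" "(A *v z, 0)"] by (simp add: z'_def)
  qed
  moreover have "orthogonal_matrix A"
    unfolding A_def by (rule orthogonal_frame_matrix[OF p(1) \<sigma>])
  ultimately show thesis
    using that by blast
qed

theorem theoremB:
  shows "\<exists>\<epsilon>\<^sub>0 > 0. \<exists>C > 0. \<forall>\<epsilon> (f :: heis \<Rightarrow> heis).
    0 < \<epsilon> \<and> \<epsilon> \<le> \<epsilon>\<^sub>0 \<and> heis_biLipschitz (1 + \<epsilon>) f \<and> f 0 = 0 \<longrightarrow>
    (\<forall>R > 0. \<exists>A :: real ^ 2 ^ 2. orthogonal_matrix A \<and>
      (\<forall>z :: real ^ 2. norm z \<le> R \<longrightarrow>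
        control_dist (f (z, 0)) (A *v z, 0) \<le> C * \<epsilon> powr (1 / 16) * R))"
proof (rule exI[of _ "(1/1000) ^ 8"], intro conjI, simp, rule exI[of _ 90], intro conjI, simp, intro allI impI, elim conjE)
  fix \<epsilon> R :: real and f :: "heis \<Rightarrow> heis"
  assume \<epsilon>: "0 < \<epsilon>" "\<epsilon> \<le> (1/1000) ^ 8" and f: "heis_biLipschitz (1 + \<epsilon>) f" "f 0 = 0" and "R > 0"
  \<comment> \<open>The bound on \<open>\<epsilon>\<close> is the eighth power of the bound
    \<open>1/1000\<close> under which the unit disc estimate holds; the constant 90 is taken over
    from that estimate.\<close>
  define \<mu> where "\<mu> = \<epsilon> powr (1/8)"
  have "\<mu> > 0"
    using \<epsilon>(1) by (simp add: \<mu>_def)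
  have \<mu>8: "\<epsilon> = \<mu> ^ 8"
    using \<epsilon>(1) by (simp add: \<mu>_def powr_power)
  have "\<mu> \<le> 1/1000"
    using \<epsilon>(2) \<open>\<mu> > 0\<close> power_mono_iff[of \<mu> "1/1000" 8] by (simp add: \<mu>8)
  have sqrt_\<mu>: "sqrt \<mu> = \<epsilon> powr (1/16)"
    using \<epsilon>(1) by (simp add: \<mu>_def powr_half_sqrt[symmetric] powr_powr)
  \<comment> \<open>Dilating by \<open>R\<close> reduces the disc of radius \<open>R\<close> to the
    unit disc; the matrix is linear and commutes with dilations, so it serves for \<open>f\<close>
    unchanged.\<close>
  define g where "g = (\<lambda>P. heis_dilation (inverse R) (f (heis_dilation R P)))"
  have g: "heis_biLipschitz (1 + \<epsilon>) g" "g 0 = 0"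
    using heis_biLipschitz_dilation_conj[OF f(1) \<open>R > 0\<close>] f(2) by (simp_all add: g_def)
  obtain A :: "real ^ 2 ^ 2" where A: "orthogonal_matrix A"
    "\<And>z. norm z \<le> 1 \<Longrightarrow> control_dist (g (z, 0)) (A *v z, 0) \<le> 90 * sqrt \<mu>"
    using biLipschitz_unit_disc[OF g \<mu>8 \<open>\<mu> > 0\<close> \<open>\<mu> \<le> 1/1000\<close>] by blast
  have "control_dist (f (z, 0)) (A *v z, 0) \<le> 90 * \<epsilon> powr (1 / 16) * R" if "norm z \<le> R" for z
  proof -
    define y where "y = inverse R *\<^sub>R z"
    have "norm y \<le> 1"
      using that \<open>R > 0\<close> by (simp add: y_def field_simps)
    have y: "heis_dilation R (y, 0) = (z, 0)"
      using \<open>R > 0\<close> by (simp add: heis_dilation_def y_def)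
    have Ay: "(A *v y, 0) = heis_dilation (inverse R) (A *v z, 0)"
      by (simp add: heis_dilation_def y_def matrix_vector_mult_scaleR)
    have "inverse R * control_dist (f (z, 0)) (A *v z, 0) = control_dist (g (y, 0)) (A *v y, 0)"
      unfolding Ay g_def y using \<open>R > 0\<close> by (intro control_dist_dilation[symmetric]) simp
    also have "\<dots> \<le> 90 * sqrt \<mu>"
      by (rule A(2)[OF \<open>norm y \<le> 1\<close>])
    finally show ?thesis
      using \<open>R > 0\<close> by (simp add: sqrt_\<mu> field_simps)
  qed
  with A(1) show "\<exists>A :: real ^ 2 ^ 2. orthogonal_matrix A \<and>
      (\<forall>z :: real ^ 2. norm z \<le> R \<longrightarrow>
        control_dist (f (z, 0)) (A *v z, 0) \<le> 90 * \<epsilon> powr (1 / 16) * R)"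
    by blast
qed

end
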